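(* (a) The pair $(\operatorname{cpk},\operatorname{cdes})$ is cyclic shuffle-compatible. (b) Let $$u_{n,j,k}=\frac{t^{j+1}(y+t)^{k-j}(1+yt)^{n-j-k-1}(1+y)^{2j+1}}{(1-t)^{n+1}}x^{n}$$ and let \begin{align*} v_{n,j,k} & =j\,u_{n,j-1,k}+j\,u_{n,j-1,k-1}+(k-j)\,u_{n,j,k-1}+(n-j-k)\,u_{n,j,k}\\ & =\bigl[j(y+t)(1+yt)(1+y+t+yt)+\bigl((k-j)(1+yt)+(n-j-k)(y+t)\bigr)t(1+y)^{2}\bigr]\\ & \qquad\times\frac{t^{j}(y+t)^{k-j-1}(1+yt)^{n-j-k-1}(1+y)^{2j-1}}{(1-t)^{n+1}}x^{n}. \end{align*} Then the linear map on $\mathcal{A}_{(\operatorname{cpk},\operatorname{cdes})}^{\mathrm{cyc}}$ defined by $$[\pi]_{(\operatorname{cpk},\operatorname{cdes})}\mapsto\begin{cases} v_{|\pi|,\operatorname{cpk}[\pi],\operatorname{cdes}[\pi]}, & \text{if }|\pi|\geq1,\\ 1/(1-t), & \text{if }|\pi|=0,\end{cases}$$ is a $\mathbb{Q}$-algebra homomorphism from $\mathcal{A}_{(\operatorname{cpk},\operatorname{cdes})}^{\mathrm{cyc}}$ to the span of $$\left\{ \frac{1}{1-t},\frac{t(1+y)}{(1-t)^{2}}x\right\} \cup\{v_{n,j,k}\}_{n\geq2,\ 1\leq j\leq\lfloor n/2\rfloor,\ j\leq k\leq n-j},$$ a subalgebra of $\mathbb{Q}[[t*]][x,y]$. (c)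 For all $n\geq2$, the $n$th homogeneous component of $\mathcal{A}_{(\operatorname{cpk},\operatorname{cdes})}^{\mathrm{cyc}}$ has dimension $\lfloor n^{2}/4\rfloor$.
   Context: A (linear) permutation of length $n\ge 0$ is a sequence $\pi=\pi_1\cdots\pi_n$ of $n$ distinct positive integers; $|\pi|=n$; $\mathfrak{P}_n$ is the set of permutations of length $n$. Two permutations are disjoint if they have no letter in common, and have the same relative order if they have the same standardization (replace the $i$th smallest letter by $i$). For disjoint $\pi\in\mathfrak{P}_m$, $\sigma\in\mathfrak{P}_n$, $\operatorname{Sh}(\pi,\sigma)$ is the set of $\tau\in\mathfrak{P}_{m+n}$ having both $\pi$ and $\sigma$ as subsequences. The cyclic permutation $[\pi]$ is the set of all rotations of $\pi$; its length is $|\pi|$. A cyclic permutation statistic is a function $\operatorname{cst}$ on cyclic permutations with $\operatorname{cst}[\pi]=\operatorname{cst}[\sigma]$ whenever $\pi,\sigma$ have the same relative order. For disjoint $\pi,\sigma$, $\operatorname{cSh}([\pi],[\sigma])$ is the set of all $[\tau]$ with $\tau\in\operatorname{Sh}(\bar\pi,\bar\sigma)$ for some $\bar\pi\in[\pi]$, $\bar\sigma\in[\sigma]$. The statistic $\operatorname{cst}$ is cyclic shuffle-compatible if for disjoint $\pi,\sigma$ the multiset $\{\{\operatorname{cst}[\tau]:[\tau]\in\operatorname{cSh}([\pi],[\sigma])\}\}$ depends only on $\operatorname{cst}[\pi],\operatorname{cst}[\sigma],|\pi|,|\sigma|$. $[\pi]_{\operatorname{cst}}$ denotes the equivalence class of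 $[\pi]$ under: $[\pi]\sim[\sigma]$ iff $\operatorname{cst}[\pi]=\operatorname{cst}[\sigma]$ and $|\pi|=|\sigma|$. $\mathcal{A}^{\mathrm{cyc}}_{\operatorname{cst}}$ is the $\mathbb{Q}$-vector space with basis these classes; when $\operatorname{cst}$ is cyclic shuffle-compatible it is a $\mathbb{Q}$-algebra with multiplication $[\pi]_{\operatorname{cst}}[\sigma]_{\operatorname{cst}}=\sum_{[\tau]\in\operatorname{cSh}([\pi],[\sigma])}[\tau]_{\operatorname{cst}}$ for $\pi,\sigma$ disjoint. It is graded by length: the $n$th homogeneous component is spanned by the classes of cyclic permutations of length $n$. For $\pi\in\mathfrak{P}_n$ (indices modulo $n$): $\operatorname{cdes}[\pi]=\operatorname{cdes}\pi$ is the number of $i\in[n]$ with $\pi_i>\pi_{i+1}$, and $\operatorname{cpk}[\pi]=\operatorname{cpk}\pi$ is the number of $i\in[n]$ with $\pi_{i-1}<\pi_i>\pi_{i+1}$; both are invariant under rotation. $(\operatorname{cpk},\operatorname{cdes})$ is the statistic $[\pi]\mapsto(\operatorname{cpk}[\pi],\operatorname{cdes}[\pi])$. $\mathbb{Q}[[t*]]$ is the $\mathbb{Q}$-algebra of formal power series in $t$ under the Hadamard product $\bigl(\sum_n a_nt^n\bigr)*\bigl(\sum_n b_nt^n\bigr)=\sum_n a_nb_nt^n$; in $\mathbb{Q}[[t*]][x,y]$ the variables $x,y$ multiply as usual. All products in the displayed formulas for $u_{n,j,k}$ and $v_{n,j,k}$ are ordinary products (of rational functions expanded as power series in $t$); the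 Hadamard product in $t$ is used only to multiply elements of the span. Terms with coefficient $0$ are read as $0$. *)

theory Defs
  imports
    "HOL-Computational_Algebra.Computational_Algebra"
    "HOL-Library.Poly_Mapping"
    "HOL-Library.Sublist"
begin

section \<open>Cyclic permutations and cyclic shuffles\<close>

definition is_perm :: "nat list \<Rightarrow> bool" where
  "is_perm \<pi> \<longleftrightarrow> distinct \<pi> \<and> 0 \<notin> set \<pi>"

definition std :: "nat list \<Rightarrow> nat list" where
  "std \<pi> = map (\<lambda>a. card {b \<in> set \<pi>. b \<le> a}) \<pi>"

definition disjoint_perms :: "nat list \<Rightarrow> nat list \<Rightarrow> bool" where
  "disjoint_perms \<pi> \<sigma> \<longleftrightarrow> is_perm \<pi> \<and> is_perm \<sigma> \<and> set \<pi> \<inter> set \<sigma> = {}"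

definition Sh :: "nat list \<Rightarrow> nat list \<Rightarrow> nat list set" where
  "Sh \<pi> \<sigma> = {\<tau>. is_perm \<tau> \<and> length \<tau> = length \<pi> + length \<sigma> \<and> subseq \<pi> \<tau> \<and> subseq \<sigma> \<tau>}"

type_synonym cperm = "nat list set"

definition cyc :: "nat list \<Rightarrow> cperm" where
  "cyc \<pi> = range (\<lambda>k. rotate k \<pi>)"

definition cSh :: "cperm \<Rightarrow> cperm \<Rightarrow> cperm set" where
  "cSh C D = {cyc \<tau> | \<tau> \<pi> \<sigma>. \<pi> \<in> C \<and> \<sigma> \<in> D \<and> \<tau> \<in> Sh \<pi> \<sigma>}"

text \<open>The value on a cyclic permutation of a rotation-invariant function on permutations.\<close>

definition on_cyc :: "(nat list \<Rightarrow> 'a) \<Rightarrow> cperm \<Rightarrow> 'a" where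
  "on_cyc f C = the_elem (f ` C)"

lemma on_cyc_cyc:
  assumes "\<And>k. f (rotate k \<pi>) = f \<pi>"
  shows "on_cyc f (cyc \<pi>) = f \<pi>"
proof -
  have "f ` cyc \<pi> = {f \<pi>}"
    using assms unfolding cyc_def image_image by simp
  then show ?thesis by (simp add: on_cyc_def)
qed

abbreviation clen :: "cperm \<Rightarrow> nat" where
  "clen \<equiv> on_cyc length"

lemma clen_cyc [simp]: "clen (cyc \<pi>) = length \<pi>"
  by (rule on_cyc_cyc) simp

definition cyclic_statistic :: "(cperm \<Rightarrow> 'a) \<Rightarrow> bool" where
  "cyclic_statistic cst \<longleftrightarrow>
     (\<forall>\<pi> \<sigma>. is_perm \<pi> \<and> is_perm \<sigma> \<and> std \<pi> = std \<sigma> \<longrightarrow> cst (cyc \<pi>) = cst (cyc \<sigma>))"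

definition cyclic_shuffle_compatible :: "(cperm \<Rightarrow> 'a) \<Rightarrow> bool" where
  "cyclic_shuffle_compatible cst \<longleftrightarrow> cyclic_statistic cst \<and>
     (\<forall>\<pi> \<sigma> \<pi>' \<sigma>'. disjoint_perms \<pi> \<sigma> \<and> disjoint_perms \<pi>' \<sigma>' \<and>
        cst (cyc \<pi>) = cst (cyc \<pi>') \<and> cst (cyc \<sigma>) = cst (cyc \<sigma>') \<and>
        length \<pi> = length \<pi>' \<and> length \<sigma> = length \<sigma>' \<longrightarrow>
        image_mset cst (mset_set (cSh (cyc \<pi>) (cyc \<sigma>))) =
        image_mset cst (mset_set (cSh (cyc \<pi>') (cyc \<sigma>'))))"

text \<open>The multisets above range over finite sets, where \<^const>\<open>mset_set\<close> is meaningful.\<close>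

lemma finite_cyc: "finite (cyc \<pi>)"
proof (rule finite_subset)
  show "cyc \<pi> \<subseteq> {xs. set xs \<subseteq> set \<pi> \<and> length xs = length \<pi>}"
    by (auto simp: cyc_def)
qed (simp add: finite_lists_length_eq)

lemma Sh_set:
  assumes "disjoint_perms \<pi> \<sigma>" "\<tau> \<in> Sh \<pi> \<sigma>"
  shows "set \<tau> = set \<pi> \<union> set \<sigma>"
proof -
  have "set \<pi> \<union> set \<sigma> \<subseteq> set \<tau>"
    using assms(2) by (auto simp: Sh_def dest: list_emb_set)
  moreover have "card (set \<pi> \<union> set \<sigma>) = card (set \<tau>)"
    using assms by (simp add: Sh_def disjoint_perms_def is_perm_def card_Un_disjoint distinct_card)
  ultimately show ?thesis
    by (metis List.finite_set card_subset_eq)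
qed

lemma finite_cSh:
  assumes "disjoint_perms \<pi> \<sigma>"
  shows "finite (cSh (cyc \<pi>) (cyc \<sigma>))"
proof (rule finite_subset)
  let ?L = "{xs. set xs \<subseteq> set \<pi> \<union> set \<sigma> \<and> length xs = length \<pi> + length \<sigma>}"
  show "cSh (cyc \<pi>) (cyc \<sigma>) \<subseteq> cyc ` ?L"
  proof
    fix T assume "T \<in> cSh (cyc \<pi>) (cyc \<sigma>)"
    then obtain \<tau> k l where T: "T = cyc \<tau>" "\<tau> \<in> Sh (rotate k \<pi>) (rotate l \<sigma>)"
      by (auto simp: cSh_def cyc_def)
    have "disjoint_perms (rotate k \<pi>) (rotate l \<sigma>)"
      using assms by (simp add: disjoint_perms_def is_perm_def)
    from Sh_set[OF this T(2)] T(2) have "\<tau> \<in> ?L"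
      by (simp add: Sh_def)
    with T(1) show "T \<in> cyc ` ?L" by blast
  qed
  show "finite (cyc ` ?L)"
    by (simp add: finite_lists_length_eq)
qed

lemma clen_cSh:
  assumes "T \<in> cSh (cyc \<pi>) (cyc \<sigma>)"
  shows "clen T = length \<pi> + length \<sigma>"
  using assms by (auto simp: cSh_def cyc_def[of \<pi>] cyc_def[of \<sigma>] Sh_def)


section \<open>The cyclic shuffle algebra of a statistic\<close>

text \<open>Elements are finitely supported rational functions on the set of equivalence classes of
  cyclic permutations, written as members of the larger type of all finitely supported functions
  on sets of cyclic permutations.\<close>

definition cyc_class :: "(cperm \<Rightarrow> 'a) \<Rightarrow> cperm \<Rightarrow> cperm set" where
  "cyc_class cst C = {cyc \<sigma> | \<sigma>. is_perm \<sigma> \<and> cst (cyc \<sigma>) = cst C \<and> clen (cyc \<sigma>) = clen C}"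

type_synonym cvec = "cperm set \<Rightarrow>\<^sub>0 rat"

definition basis_vec :: "(cperm \<Rightarrow> 'a) \<Rightarrow> cperm \<Rightarrow> cvec" where
  "basis_vec cst C = Poly_Mapping.single (cyc_class cst C) 1"

definition cscale :: "rat \<Rightarrow> cvec \<Rightarrow> cvec" where
  "cscale q f = Poly_Mapping.map ((*) q) f"

definition cyc_alg :: "(cperm \<Rightarrow> 'a) \<Rightarrow> cvec set" where
  "cyc_alg cst = {f. Poly_Mapping.keys f \<subseteq> {cyc_class cst (cyc \<pi>) | \<pi>. is_perm \<pi>}}"

definition cyc_alg_comp :: "(cperm \<Rightarrow> 'a) \<Rightarrow> nat \<Rightarrow> cvec set" where
  "cyc_alg_comp cst n =
     module.span cscale {basis_vec cst (cyc \<pi>) | \<pi>. is_perm \<pi> \<and> length \<pi> = n}"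

text \<open>The product of two classes is the common value of the shuffle sums over all disjoint
  representatives. It is well defined for cyclic shuffle-compatible statistics, see
  \<open>class_mult\<close> below.\<close>

definition class_times :: "(cperm \<Rightarrow> 'a) \<Rightarrow> cperm set \<Rightarrow> cperm set \<Rightarrow> cvec" where
  "class_times cst A B = (THE f. \<forall>\<pi> \<sigma>. disjoint_perms \<pi> \<sigma> \<and>
      cyc_class cst (cyc \<pi>) = A \<and> cyc_class cst (cyc \<sigma>) = B \<longrightarrow>
      f = (\<Sum>T\<in>cSh (cyc \<pi>) (cyc \<sigma>). basis_vec cst T))"

definition ctimes :: "(cperm \<Rightarrow> 'a) \<Rightarrow> cvec \<Rightarrow> cvec \<Rightarrow> cvec" where
  "ctimes cst f g = (\<Sum>A\<in>Poly_Mapping.keys f. \<Sum>B\<in>Poly_Mapping.keys g.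
      cscale (Poly_Mapping.lookup f A * Poly_Mapping.lookup g B) (class_times cst A B))"

definition cone :: "(cperm \<Rightarrow> 'a) \<Rightarrow> cvec" where
  "cone cst = basis_vec cst (cyc [])"

lemma lookup_cscale: "Poly_Mapping.lookup (cscale q f) k = q * Poly_Mapping.lookup f k"
  by (simp add: cscale_def map.rep_eq when_def)

interpretation cvec: vector_space cscale
  by unfold_locales
     (auto intro!: poly_mapping_eqI simp: lookup_cscale lookup_add algebra_simps)

lemma cyc_class_eq_iff:
  assumes "is_perm \<pi>" "is_perm \<sigma>"
  shows "cyc_class cst (cyc \<pi>) = cyc_class cst (cyc \<sigma>) \<longleftrightarrow>
           cst (cyc \<pi>) = cst (cyc \<sigma>) \<and> length \<pi> = length \<sigma>"
proof
  assume eq: "cyc_class cst (cyc \<pi>) = cyc_class cst (cyc \<sigma>)"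
  have "cyc \<pi> \<in> cyc_class cst (cyc \<pi>)"
    using assms by (auto simp: cyc_class_def)
  then have "cyc \<pi> \<in> cyc_class cst (cyc \<sigma>)"
    using eq by simp
  then obtain \<rho> where "cyc \<pi> = cyc \<rho>" "cst (cyc \<rho>) = cst (cyc \<sigma>)" "length \<rho> = length \<sigma>"
    by (auto simp: cyc_class_def)
  then show "cst (cyc \<pi>) = cst (cyc \<sigma>) \<and> length \<pi> = length \<sigma>"
    by (metis clen_cyc)
next
  assume "cst (cyc \<pi>) = cst (cyc \<sigma>) \<and> length \<pi> = length \<sigma>"
  then show "cyc_class cst (cyc \<pi>) = cyc_class cst (cyc \<sigma>)"
    by (simp add: cyc_class_def)
qed

lemma shuffle_sum_eq:
  "(\<Sum>T\<in>cSh (cyc \<pi>) (cyc \<sigma>). basis_vec cst T) =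
     (\<Sum>v\<in>#image_mset cst (mset_set (cSh (cyc \<pi>) (cyc \<sigma>))).
        Poly_Mapping.single
          {cyc \<rho> | \<rho>. is_perm \<rho> \<and> cst (cyc \<rho>) = v \<and> clen (cyc \<rho>) = length \<pi> + length \<sigma>} 1)"
proof -
  have "(\<Sum>T\<in>cSh (cyc \<pi>) (cyc \<sigma>). basis_vec cst T) =
        (\<Sum>T\<in>cSh (cyc \<pi>) (cyc \<sigma>). Poly_Mapping.single
          {cyc \<rho> | \<rho>. is_perm \<rho> \<and> cst (cyc \<rho>) = cst T \<and> clen (cyc \<rho>) = length \<pi> + length \<sigma>} 1)"
    by (rule sum.cong) (auto simp: basis_vec_def cyc_class_def clen_cSh)
  then show ?thesis
    by (simp add: sum_unfold_sum_mset image_mset.compositionality comp_def)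
qed

lemma class_times_eq:
  assumes compat: "cyclic_shuffle_compatible cst" and disj: "disjoint_perms \<pi> \<sigma>"
  shows "class_times cst (cyc_class cst (cyc \<pi>)) (cyc_class cst (cyc \<sigma>)) =
           (\<Sum>T\<in>cSh (cyc \<pi>) (cyc \<sigma>). basis_vec cst T)"
  unfolding class_times_def
proof (rule the_equality)
  show "\<forall>\<pi>' \<sigma>'. disjoint_perms \<pi>' \<sigma>' \<and> cyc_class cst (cyc \<pi>') = cyc_class cst (cyc \<pi>) \<and>
          cyc_class cst (cyc \<sigma>') = cyc_class cst (cyc \<sigma>) \<longrightarrow>
          (\<Sum>T\<in>cSh (cyc \<pi>) (cyc \<sigma>). basis_vec cst T) =
          (\<Sum>T\<in>cSh (cyc \<pi>') (cyc \<sigma>'). basis_vec cst T)"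
  proof (intro allI impI)
    fix \<pi>' \<sigma>'
    assume *: "disjoint_perms \<pi>' \<sigma>' \<and> cyc_class cst (cyc \<pi>') = cyc_class cst (cyc \<pi>) \<and>
          cyc_class cst (cyc \<sigma>') = cyc_class cst (cyc \<sigma>)"
    then have eqs: "cst (cyc \<pi>) = cst (cyc \<pi>')" "length \<pi> = length \<pi>'"
        "cst (cyc \<sigma>) = cst (cyc \<sigma>')" "length \<sigma> = length \<sigma>'"
      using disj cyc_class_eq_iff[of \<pi>' \<pi> cst] cyc_class_eq_iff[of \<sigma>' \<sigma> cst]
      by (simp_all add: disjoint_perms_def)
    then have "image_mset cst (mset_set (cSh (cyc \<pi>) (cyc \<sigma>))) =
               image_mset cst (mset_set (cSh (cyc \<pi>') (cyc \<sigma>')))"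
      using compat * disj unfolding cyclic_shuffle_compatible_def by blast
    then show "(\<Sum>T\<in>cSh (cyc \<pi>) (cyc \<sigma>). basis_vec cst T) =
               (\<Sum>T\<in>cSh (cyc \<pi>') (cyc \<sigma>'). basis_vec cst T)"
      unfolding shuffle_sum_eq eqs by simp
  qed
qed (use disj in blast)

lemma class_mult:
  assumes "cyclic_shuffle_compatible cst" "disjoint_perms \<pi> \<sigma>"
  shows "ctimes cst (basis_vec cst (cyc \<pi>)) (basis_vec cst (cyc \<sigma>)) =
           (\<Sum>T\<in>cSh (cyc \<pi>) (cyc \<sigma>). basis_vec cst T)"
  using class_times_eq[OF assms] by (simp add: ctimes_def basis_vec_def)


section \<open>Cyclic descents and cyclic peaks\<close>

text \<open>Positions are counted from 0 here, so the predecessor of \<open>i\<close> modulo \<open>n\<close> is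
  \<open>(i + n - 1) mod n\<close>.\<close>

definition cdes :: "nat list \<Rightarrow> nat" where
  "cdes \<pi> = (let n = length \<pi> in card {i. i < n \<and> \<pi> ! i > \<pi> ! ((i + 1) mod n)})"

definition cpk :: "nat list \<Rightarrow> nat" where
  "cpk \<pi> = (let n = length \<pi> in
     card {i. i < n \<and> \<pi> ! ((i + n - 1) mod n) < \<pi> ! i \<and> \<pi> ! i > \<pi> ! ((i + 1) mod n)})"

definition cpk_cdes :: "cperm \<Rightarrow> nat \<times> nat" where
  "cpk_cdes C = (on_cyc cpk C, on_cyc cdes C)"

lemma card_shift_mod:
  fixes n k :: nat
  shows "card {i. i < n \<and> P ((k + i) mod n)} = card {i. i < n \<and> P i}"
proof (cases "n = 0")
  case False
  let ?f = "\<lambda>i. (k + i) mod n"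
  have "i = j" if "i \<le> j" "j < n" "?f i = ?f j" for i j
  proof -
    have "n dvd j - i"
      using that mod_eq_dvd_iff_nat[of "k + i" "k + j" n] by simp
    moreover have "j - i < n" using that by simp
    ultimately have "j - i = 0" by (metis gr0I nat_dvd_not_less)
    then show ?thesis using that by simp
  qed
  then have inj: "inj_on ?f {..<n}"
    by (intro inj_onI) (metis lessThan_iff nle_le)
  have surj: "?f ` {..<n} = {..<n}"
    using inj False by (intro endo_inj_surj) auto
  have "?f ` {i. i < n \<and> P (?f i)} = {i. i < n \<and> P i}"
  proof (intro equalityI subsetI)
    fix j assume j: "j \<in> {i. i < n \<and> P i}"
    then have "j \<in> ?f ` {..<n}" unfolding surj by simp
    then show "j \<in> ?f ` {i. i < n \<and> P (?f i)}" using j by blast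
  qed (use False in auto)
  moreover have "inj_on ?f {i. i < n \<and> P (?f i)}"
    using inj by (rule inj_on_subset) auto
  note card_image[OF this]
  ultimately show ?thesis by simp
qed simp

lemma cdes_rotate [simp]: "cdes (rotate k \<pi>) = cdes \<pi>"
proof -
  define n where "n = length \<pi>"
  have succ: "(k + (i + 1) mod n) mod n = ((k + i) mod n + 1) mod n" for i
    by (simp add: mod_simps)
  have lt: "(i + 1) mod n < n" if "i < n" for i
    using that by simp
  have "cdes (rotate k \<pi>) =
      card {i. i < n \<and> \<pi> ! ((k + i) mod n) > \<pi> ! (((k + i) mod n + 1) mod n)}"
    unfolding cdes_def Let_def length_rotate n_def[symmetric]
    by (intro arg_cong[where f = card] Collect_cong conj_cong refl)
       (simp only: nth_rotate lt succ n_def[symmetric])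
  also have "\<dots> = cdes \<pi>"
    by (subst card_shift_mod) (simp add: cdes_def n_def Let_def)
  finally show ?thesis .
qed

lemma cpk_rotate [simp]: "cpk (rotate k \<pi>) = cpk \<pi>"
proof -
  define n where "n = length \<pi>"
  have pred: "(k + (i + n - 1) mod n) mod n = ((k + i) mod n + n - 1) mod n" if "i < n" for i
  proof -
    have *: "a + n - 1 = a + (n - 1)" for a
      using that by simp
    show ?thesis
      unfolding * by (simp add: mod_simps add.assoc)
  qed
  have succ: "(k + (i + 1) mod n) mod n = ((k + i) mod n + 1) mod n" for i
    by (simp add: mod_simps)
  have lt: "(i + n - 1) mod n < n" "(i + 1) mod n < n" if "i < n" for i
    using that by simp_all
  have "cpk (rotate k \<pi>) =
      card {i. i < n \<and> \<pi> ! (((k + i) mod n + n - 1) mod n) < \<pi> ! ((k + i) mod n) \<and>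
                       \<pi> ! ((k + i) mod n) > \<pi> ! (((k + i) mod n + 1) mod n)}"
    unfolding cpk_def Let_def length_rotate n_def[symmetric]
    by (intro arg_cong[where f = card] Collect_cong conj_cong refl)
       (simp_all only: nth_rotate lt pred succ n_def[symmetric])
  also have "\<dots> = cpk \<pi>"
    by (subst card_shift_mod) (simp add: cpk_def n_def Let_def)
  finally show ?thesis .
qed

lemma cpk_cdes_cyc [simp]: "cpk_cdes (cyc \<pi>) = (cpk \<pi>, cdes \<pi>)"
  by (simp add: cpk_cdes_def on_cyc_cyc)


section \<open>The algebra \<open>\<rat>[[t*]][x,y]\<close>\<close>

text \<open>A copy of the type of rational power series, whose product is the Hadamard product.\<close>

typedef hps = "UNIV :: rat fps set" morphisms fps_of_hps hps_of_fps ..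

setup_lifting type_definition_hps

instantiation hps :: comm_ring_1
begin

lift_definition zero_hps :: hps is 0 .

lift_definition one_hps :: hps is "Abs_fps (\<lambda>_. 1)" .

lift_definition plus_hps :: "hps \<Rightarrow> hps \<Rightarrow> hps" is "(+)" .

lift_definition minus_hps :: "hps \<Rightarrow> hps \<Rightarrow> hps" is "(-)" .

lift_definition uminus_hps :: "hps \<Rightarrow> hps" is uminus .

lift_definition times_hps :: "hps \<Rightarrow> hps \<Rightarrow> hps" is
  "\<lambda>a b. Abs_fps (\<lambda>n. fps_nth a n * fps_nth b n)" .

instance
  by standard (transfer, simp add: fps_eq_iff algebra_simps)+

end

lift_definition hscale :: "rat \<Rightarrow> hps \<Rightarrow> hps" is "\<lambda>q a. fps_const q * a" .

text \<open>The outer polynomial variable is \<open>x\<close>, the inner one is \<open>y\<close>.\<close>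

type_synonym target = "hps poly poly"

definition tscale :: "rat \<Rightarrow> target \<Rightarrow> target" where
  "tscale q = map_poly (map_poly (hscale q))"

lemma hscale_0 [simp]: "hscale q 0 = 0"
  by transfer simp

lemma coeff_tscale: "coeff (coeff (tscale q P) n) i = hscale q (coeff (coeff P n) i)"
  by (simp add: tscale_def coeff_map_poly)

interpretation target: vector_space tscale
proof -
  have "hscale q (a + b) = hscale q a + hscale q b" "hscale (q + r) a = hscale q a + hscale r a"
    "hscale q (hscale r a) = hscale (q * r) a" "hscale 1 a = a" for q r a b
    by (transfer, simp add: fps_eq_iff algebra_simps)+
  then show "vector_space tscale"
    by unfold_locales (auto intro!: poly_eqI simp: coeff_tscale)
qed

definition is_subalgebra :: "target set \<Rightarrow> bool" where
  "is_subalgebra B \<longleftrightarrow> target.subspace B \<and> 1 \<in> B \<and> (\<forall>p\<in>B. \<forall>q\<in>B. p * q \<in> B)"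

text \<open>A linear map on \<^term>\<open>cyc_alg cst\<close> is represented by a linear map on the ambient space
  of finitely supported functions; only its values on \<^term>\<open>cyc_alg cst\<close> matter.\<close>

definition is_cyc_alg_hom :: "(cperm \<Rightarrow> 'a) \<Rightarrow> (cvec \<Rightarrow> target) \<Rightarrow> target set \<Rightarrow> bool" where
  "is_cyc_alg_hom cst \<phi> B \<longleftrightarrow>
     Vector_Spaces.linear cscale tscale \<phi> \<and>
     \<phi> ` cyc_alg cst \<subseteq> B \<and>
     \<phi> (cone cst) = 1 \<and>
     (\<forall>f\<in>cyc_alg cst. \<forall>g\<in>cyc_alg cst. \<phi> (ctimes cst f g) = \<phi> f * \<phi> g)"


section \<open>The series \<open>u\<close> and \<open>v\<close>\<close>

text \<open>Rational functions in \<open>t\<close> and \<open>y\<close>, expanded in powers of \<open>t\<close>, live in the field of Laurent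
  series in \<open>t\<close> over the field of rational functions in \<open>y\<close>. All products are ordinary there, and
  negative exponents are meaningful.\<close>

type_synonym lau = "rat poly fract fls"

definition tvar :: lau where "tvar = fls_X"

definition yvar :: lau where "yvar = fls_const (to_fract [:0, 1:])"

definition useries :: "nat \<Rightarrow> int \<Rightarrow> int \<Rightarrow> lau poly" where
  "useries n j k = monom
     (tvar powi (j + 1) * (yvar + tvar) powi (k - j) * (1 + yvar * tvar) powi (int n - j - k - 1)
        * (1 + yvar) powi (2 * j + 1) / (1 - tvar) ^ (n + 1)) n"

definition vseries :: "nat \<Rightarrow> int \<Rightarrow> int \<Rightarrow> lau poly" where
  "vseries n j k = of_int j * useries n (j - 1) k + of_int j * useries n (j - 1) (k - 1)
     + of_int (k - j) * useries n j (k - 1) + of_int (int n - j - k) * useries n j k"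

text \<open>The embedding of \<open>\<rat>[[t*]][x,y]\<close> (as a vector space) into polynomials in \<open>x\<close> over
  \<^typ>\<open>lau\<close>. The coefficient of \<open>t\<^sup>m\<close> in an element of \<open>\<rat>[[t*]][y]\<close> is a polynomial in \<open>y\<close>.\<close>

definition lau_of :: "hps poly \<Rightarrow> lau" where
  "lau_of p = fps_to_fls
     (Abs_fps (\<lambda>m. to_fract (map_poly (\<lambda>a. fps_nth (fps_of_hps a) m) p)))"

definition embed_lau :: "target \<Rightarrow> lau poly" where
  "embed_lau = map_poly lau_of"

lemma lau_of_0 [simp]: "lau_of 0 = 0"
  by (simp add: lau_of_def fps_zero_def[symmetric])

lemma inj_embed_lau: "inj embed_lau"
proof (rule injI)
  fix p q assume eq: "embed_lau p = embed_lau q"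
  have "fps_nth (fps_of_hps (coeff (coeff p n) i)) m = fps_nth (fps_of_hps (coeff (coeff q n) i)) m"
    for n i m
  proof -
    have "lau_of (coeff p n) = lau_of (coeff q n)"
      using eq by (metis coeff_map_poly embed_lau_def lau_of_0)
    then have "map_poly (\<lambda>a. fps_nth (fps_of_hps a) m) (coeff p n) =
               map_poly (\<lambda>a. fps_nth (fps_of_hps a) m) (coeff q n)"
      by (simp add: lau_of_def fps_eq_iff)
    then show ?thesis
      by (metis (no_types, lifting) coeff_map_poly fps_zero_nth zero_hps.rep_eq)
  qed
  then show "p = q"
    by (intro poly_eqI) (metis fps_ext fps_of_hps_inject)
qed

text \<open>The element of \<open>\<rat>[[t*]][x,y]\<close> with the given expansion; meaningful on the range of
  \<^const>\<open>embed_lau\<close>.\<close>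

definition as_target :: "lau poly \<Rightarrow> target" where
  "as_target r = inv embed_lau r"

definition gens :: "lau poly set" where
  "gens = {monom (1 / (1 - tvar)) 0, monom (tvar * (1 + yvar) / (1 - tvar) ^ 2) 1} \<union>
     {vseries n (int j) (int k) | n j k. n \<ge> 2 \<and> 1 \<le> j \<and> j \<le> n div 2 \<and> j \<le> k \<and> k \<le> n - j}"

end

theory Submission
  imports Defs
begin

text \<open>
  The proof realizes every cyclic permutation by a counting polynomial for which
  multiplicativity is evident, and then reads the statistics off its generating function.

  Fix \<open>m\<close>. Cut a word into \<open>2m\<close> consecutive, possibly empty blocks which are alternately
  decreasing and increasing, and give each letter in a decreasing block the weight \<open>y\<close>. The sum
  \<open>alt_weight m w\<close> of the weights of all such cuts of \<open>w\<close> is multiplicative over shuffles: for a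
  single monotone block this says that two disjoint monotone words have exactly one monotone
  shuffle, and the convolution of two multiplicative functions is multiplicative because
  deconcatenation is compatible with shuffling (\<open>shuffle_sum_conv\<close>). Distinguishing the
  factorizations by the type of the block of the first letter gives a linear recursion for
  \<open>\<Sum>m. alt_weight m w * t^m\<close>: an ascent contributes a factor \<open>(1 + yt)/(1 - t)\<close>, a descent a
  factor \<open>(y + t)/(1 - t)\<close>, and an ascent followed by a descent, that is a peak, a further factor
  \<open>t(1 + y)^2/((y + t)(1 + yt))\<close>. Hence this series is the coefficient of \<open>x^n\<close> in \<open>u\<close> at the
  peak and descent numbers of \<open>w\<close> (\<open>genfun_alt_weight\<close>).

  For a cyclic permutation the weights of all its rotations are added. The linear shuffles of all
  pairs of rotations of \<open>\<pi>\<close> and \<open>\<sigma>\<close> are exactly the rotations of the members of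
  \<open>cSh [\<pi>] [\<sigma>]\<close>, so the cyclic weight is multiplicative over cyclic shuffles
  (\<open>cyc_weight_mult\<close>). Among the rotations of a word with \<open>j\<close> cyclic peaks and \<open>k\<close> cyclic
  descents, \<open>j\<close> are cut just before a peak, \<open>j\<close> just after a peak, \<open>k - j\<close> at another descent and
  \<open>n - j - k\<close> at another ascent. These are the four terms of \<open>v\<close> (\<open>sum_rotations_ucoeff\<close>).

  The lowest term of \<open>v\<close> in \<open>t\<close> is \<open>j y^(k - j) (1 + y)^(2j) t^j\<close>, so for \<open>n \<ge> 2\<close> the series
  that belong to the possible pairs of values are linearly independent (\<open>vcoeff_independent\<close>).
  The sum of the series of the members of \<open>cSh [\<pi>] [\<sigma>]\<close> is the product of the series of \<open>[\<pi>]\<close>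
  and \<open>[\<sigma>]\<close>; it therefore determines the multiset of statistics, and shuffle-compatibility
  follows. For \<open>n \<ge> 2\<close> the possible pairs are those with \<open>1 \<le> j \<le> k \<le> n - j\<close> (\<open>ex_perm_with_stats\<close>).
  This identifies the generators with the images of the classes, so that their span is closed
  under multiplication, and counting the pairs gives the dimensions.
\<close>

section \<open>Convolution and shuffle sums\<close>

definition conv :: "('a list \<Rightarrow> 'b::comm_ring_1) \<Rightarrow> ('a list \<Rightarrow> 'b) \<Rightarrow> 'a list \<Rightarrow> 'b" where
  "conv f g w = (\<Sum>i\<le>length w. f (take i w) * g (drop i w))"

lemma conv_Nil: "conv f g [] = f [] * g []"
  by (simp add: conv_def)

lemma conv_Cons: "conv f g (x # w) = f [] * g (x # w) + conv (\<lambda>u. f (x # u)) g w"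
  unfolding conv_def by (simp add: sum.atMost_Suc_shift del: sum.atMost_Suc)

text \<open>Counting shuffles with multiplicity keeps the two branches of the recursion apart even when
  the words share letters.\<close>

fun shuffle_sum :: "('a list \<Rightarrow> 'b::comm_ring_1) \<Rightarrow> 'a list \<Rightarrow> 'a list \<Rightarrow> 'b" where
  "shuffle_sum f [] w = f w"
| "shuffle_sum f v [] = f v"
| "shuffle_sum f (a # v) (b # w) =
     shuffle_sum (\<lambda>u. f (a # u)) v (b # w) + shuffle_sum (\<lambda>u. f (b # u)) (a # v) w"

lemma shuffle_sum_Nil2 [simp]: "shuffle_sum f v [] = f v"
  by (cases v) auto

lemma shuffle_sum_add: "shuffle_sum (\<lambda>u. f u + g u) v w = shuffle_sum f v w + shuffle_sum g v w"
proof (induction f v w arbitrary: g rule: shuffle_sum.induct)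
  case (3 f a v b w)
  show ?case
    unfolding shuffle_sum.simps 3(1)[of "\<lambda>u. g (a # u)"] 3(2)[of "\<lambda>u. g (b # u)"]
    by (simp only: add_ac)
qed simp_all

lemma shuffle_sum_cmult: "shuffle_sum (\<lambda>u. c * f u) v w = c * shuffle_sum f v w"
  by (induction f v w rule: shuffle_sum.induct) (simp_all add: algebra_simps)

text \<open>Deconcatenation commutes with shuffling: to cut a shuffle of \<open>v\<close> and \<open>w\<close> in two is to cut
  \<open>v\<close> and \<open>w\<close> and to shuffle the left parts and the right parts. In the induction the first letter
  of a shuffle comes from \<open>v\<close> or from \<open>w\<close> unless the left part is empty; this is why the left
  factor has to vary.\<close>

lemma shuffle_sum_conv:
  "shuffle_sum (conv f g) v w =
     (\<Sum>i\<le>length v. \<Sum>j\<le>length w.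
        shuffle_sum f (take i v) (take j w) * shuffle_sum g (drop i v) (drop j w))"
proof (induction f v w rule: shuffle_sum.induct)
  case (3 f a v b w)
  let ?R = "\<lambda>f v w i j. shuffle_sum f (take i v) (take j w) * shuffle_sum g (drop i v) (drop j w)"
  let ?v = "a # v" and ?w = "b # w" and ?fa = "\<lambda>u. f (a # u)" and ?fb = "\<lambda>u. f (b # u)"
  have "shuffle_sum (conv f g) ?v ?w =
      f [] * shuffle_sum g ?v ?w + shuffle_sum (conv ?fa g) v ?w + shuffle_sum (conv ?fb g) ?v w"
    by (simp add: conv_Cons shuffle_sum_add shuffle_sum_cmult algebra_simps)
  also have "\<dots> = f [] * shuffle_sum g ?v ?w + (\<Sum>i\<le>length v. \<Sum>j\<le>length ?w. ?R ?fa v ?w i j)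
       + (\<Sum>i\<le>length ?v. \<Sum>j\<le>length w. ?R ?fb ?v w i j)"
    by (simp only: 3)
  also have "(\<Sum>i\<le>length v. \<Sum>j\<le>length ?w. ?R ?fa v ?w i j) =
      (\<Sum>i\<le>length v. ?R ?fa v ?w i 0) + (\<Sum>i\<le>length v. \<Sum>j\<le>length w. ?R ?fa v ?w i (Suc j))"
    by (simp add: sum.atMost_Suc_shift sum.distrib del: sum.atMost_Suc)
  also have "(\<Sum>i\<le>length ?v. \<Sum>j\<le>length w. ?R ?fb ?v w i j) =
      (\<Sum>j\<le>length w. ?R ?fb ?v w 0 j) + (\<Sum>i\<le>length v. \<Sum>j\<le>length w. ?R ?fb ?v w (Suc i) j)"
    by (simp add: sum.atMost_Suc_shift del: sum.atMost_Suc)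
  also have "f [] * shuffle_sum g ?v ?w
       + ((\<Sum>i\<le>length v. ?R ?fa v ?w i 0) + (\<Sum>i\<le>length v. \<Sum>j\<le>length w. ?R ?fa v ?w i (Suc j)))
       + ((\<Sum>j\<le>length w. ?R ?fb ?v w 0 j) + (\<Sum>i\<le>length v. \<Sum>j\<le>length w. ?R ?fb ?v w (Suc i) j))
     = (\<Sum>i\<le>length ?v. \<Sum>j\<le>length ?w. ?R f ?v ?w i j)"
    by (simp add: sum.atMost_Suc_shift sum.distrib algebra_simps del: sum.atMost_Suc)
  finally show ?case .
qed (simp_all add: conv_def)

lemma shuffle_sum_eq_sum_shuffles:
  assumes "set v \<inter> set w = {}"
  shows "shuffle_sum f v w = sum f (shuffles v w)"
  using assms
proof (induction f v w rule: shuffle_sum.induct)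
  case (3 f a v b w)
  have "shuffles (a # v) (b # w) = (#) a ` shuffles v (b # w) \<union> (#) b ` shuffles (a # v) w"
    by simp
  moreover have "(#) a ` shuffles v (b # w) \<inter> (#) b ` shuffles (a # v) w = {}"
    using 3 by auto
  moreover have "sum f ((#) c ` X) = (\<Sum>u\<in>X. f (c # u))" for c X
    by (subst sum.reindex) (auto simp: inj_on_def)
  ultimately have "sum f (shuffles (a # v) (b # w)) =
      (\<Sum>u\<in>shuffles v (b # w). f (a # u)) + (\<Sum>u\<in>shuffles (a # v) w. f (b # u))"
    by (simp only: sum.union_disjoint finite_imageI finite_shuffles)
  then show ?case
    using 3 by simp
qed auto

definition shuffle_mult :: "('a list \<Rightarrow> 'b::comm_ring_1) \<Rightarrow> bool" where
  "shuffle_mult f \<longleftrightarrow> (\<forall>v w. set v \<inter> set w = {} \<longrightarrow> shuffle_sum f v w = f v * f w)"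

lemma shuffle_mult_conv:
  assumes "shuffle_mult f" "shuffle_mult g"
  shows "shuffle_mult (conv f g)"
  unfolding shuffle_mult_def
proof (intro allI impI)
  fix v w :: "'a list" assume disj: "set v \<inter> set w = {}"
  have "set (take i v) \<inter> set (take j w) = {}" "set (drop i v) \<inter> set (drop j w) = {}" for i j
    using disj by (blast dest: in_set_takeD in_set_dropD)+
  with assms have *: "shuffle_sum f (take i v) (take j w) = f (take i v) * f (take j w)"
    "shuffle_sum g (drop i v) (drop j w) = g (drop i v) * g (drop j w)" for i j
    by (simp_all add: shuffle_mult_def)
  show "shuffle_sum (conv f g) v w = conv f g v * conv f g w"
    unfolding shuffle_sum_conv * by (simp add: conv_def sum_product algebra_simps)
qed

lemma shuffle_mult_unit: "shuffle_mult (\<lambda>w. if w = [] then 1 else 0)"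
proof -
  have "shuffle_sum (\<lambda>_. 0) v w = (0::'b)" for v w :: "'a list"
    using shuffle_sum_cmult[of 0 "\<lambda>_. 0" v w] by simp
  then have "shuffle_sum (\<lambda>w. if w = [] then 1 else 0) v w =
     (if v = [] then 1 else 0) * (if w = [] then 1 else (0::'b))" for v w :: "'a list"
    by (cases v; cases w) auto
  then show ?thesis by (simp add: shuffle_mult_def)
qed

definition monotone_weight :: "('a \<Rightarrow> 'a \<Rightarrow> bool) \<Rightarrow> 'b \<Rightarrow> 'a list \<Rightarrow> 'b::comm_ring_1" where
  "monotone_weight R c w = (if sorted_wrt R w then c ^ length w else 0)"

lemma shuffle_sum_cong:
  assumes "\<And>u. u \<in> shuffles v w \<Longrightarrow> f u = g u"
  shows "shuffle_sum f v w = shuffle_sum g v w"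
  using assms
proof (induction f v w arbitrary: g rule: shuffle_sum.induct)
  case (3 f a v b w)
  have "shuffle_sum (\<lambda>u. f (a # u)) v (b # w) = shuffle_sum (\<lambda>u. g (a # u)) v (b # w)"
    by (rule 3(1)) (simp add: 3(3))
  moreover have "shuffle_sum (\<lambda>u. f (b # u)) (a # v) w = shuffle_sum (\<lambda>u. g (b # u)) (a # v) w"
    by (rule 3(2)) (simp add: 3(3))
  ultimately show ?case by simp
qed simp_all

text \<open>Two disjoint monotone words have exactly one monotone shuffle, and a word with a monotone
  shuffle is monotone.\<close>

lemma shuffle_mult_monotone_weight:
  fixes R :: "'a \<Rightarrow> 'a \<Rightarrow> bool" and c :: "'b::comm_ring_1"
  assumes R: "transp R" "asymp R" "totalp R"
  shows "shuffle_mult (monotone_weight R c)"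
  unfolding shuffle_mult_def
proof (intro allI impI)
  let ?m = "monotone_weight R c"
  have step: "shuffle_sum (\<lambda>u. ?m (x # u)) v w =
      (if \<forall>z\<in>set v \<union> set w. R x z then c * shuffle_sum ?m v w else 0)" for x v w
  proof -
    have "shuffle_sum (\<lambda>u. ?m (x # u)) v w =
        shuffle_sum (\<lambda>u. (if \<forall>z\<in>set v \<union> set w. R x z then c else 0) * ?m u) v w"
      by (intro shuffle_sum_cong) (auto simp: monotone_weight_def dest: set_shuffles)
    then show ?thesis by (simp add: shuffle_sum_cmult)
  qed
  fix v w :: "'a list" assume "set v \<inter> set w = {}"
  then show "shuffle_sum ?m v w = ?m v * ?m w"
  proof (induction "length v + length w" arbitrary: v w rule: less_induct)
    case less
    show ?case
    proof (cases "v = [] \<or> w = []")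
      case True
      then show ?thesis by (auto simp: monotone_weight_def)
    next
      case False
      then obtain a v' b w' where vw: "v = a # v'" "w = b # w'"
        by (meson neq_Nil_conv)
      have IH: "shuffle_sum ?m v' (b # w') = ?m v' * ?m (b # w')"
        "shuffle_sum ?m (a # v') w' = ?m (a # v') * ?m w'"
        using less.prems by (auto simp: vw intro!: less.hyps)
      have "a \<noteq> b" using less.prems vw by auto
      then consider "R a b" "\<not> R b a" | "R b a" "\<not> R a b"
        using R unfolding totalp_on_def asymp_on_def by blast
      then show ?thesis
      proof cases
        case 1
        have "R a z" if "R b z" for z
          using R(1) 1(1) that by (rule transpD)
        then have *: "(\<forall>z\<in>set v' \<union> set (b # w'). R a z) \<longleftrightarrow> (\<forall>z\<in>set v'. R a z)"
          if "?m (b # w') \<noteq> 0" using that 1 by (auto simp: monotone_weight_def split: if_splits)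
        have "shuffle_sum ?m (a # v') (b # w') =
            (if \<forall>z\<in>set v' \<union> set (b # w'). R a z then c * (?m v' * ?m (b # w')) else 0)"
          using 1 by (simp add: step IH)
        also have "\<dots> = (if \<forall>z\<in>set v'. R a z then c * ?m v' else 0) * ?m (b # w')"
          using * by (cases "?m (b # w') = 0") auto
        also have "(if \<forall>z\<in>set v'. R a z then c * ?m v' else 0) = ?m (a # v')"
          by (simp add: monotone_weight_def)
        finally show ?thesis by (simp only: vw)
      next
        case 2
        have "R b z" if "R a z" for z
          using R(1) 2(1) that by (rule transpD)
        then have *: "(\<forall>z\<in>set (a # v') \<union> set w'. R b z) \<longleftrightarrow> (\<forall>z\<in>set w'. R b z)"
          if "?m (a # v') \<noteq> 0" using that 2 by (auto simp: monotone_weight_def split: if_splits)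
        have "shuffle_sum ?m (a # v') (b # w') =
            (if \<forall>z\<in>set (a # v') \<union> set w'. R b z then c * (?m (a # v') * ?m w') else 0)"
          using 2 by (simp add: step IH)
        also have "\<dots> = ?m (a # v') * (if \<forall>z\<in>set w'. R b z then c * ?m w' else 0)"
          using * by (cases "?m (a # v') = 0") auto
        also have "(if \<forall>z\<in>set w'. R b z then c * ?m w' else 0) = ?m (b # w')"
          by (simp add: monotone_weight_def)
        finally show ?thesis by (simp only: vw)
      qed
    qed
  qed
qed

section \<open>Alternating weights and linear statistics\<close>

text \<open>The weighted count of the factorizations of a word into \<open>m\<close> pairs of a decreasing and an
  increasing block; the polynomial variable \<open>y\<close> marks letters in decreasing blocks.\<close>

fun alt_weight :: "nat \<Rightarrow> nat list \<Rightarrow> rat poly" where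
  "alt_weight 0 = (\<lambda>w. if w = [] then 1 else 0)"
| "alt_weight (Suc m) =
     conv (monotone_weight (>) [:0, 1:]) (conv (monotone_weight (<) 1) (alt_weight m))"

lemma shuffle_mult_alt_weight: "shuffle_mult (alt_weight m)"
proof (induction m)
  case 0
  show ?case using shuffle_mult_unit by simp
next
  case (Suc m)
  have "shuffle_mult (monotone_weight ((>) :: nat \<Rightarrow> _) c)"
    "shuffle_mult (monotone_weight ((<) :: nat \<Rightarrow> _) c)" for c :: "rat poly"
    by (auto intro!: shuffle_mult_monotone_weight simp: transp_def asymp_on_def totalp_on_def)
  then show ?case
    unfolding alt_weight.simps by (intro shuffle_mult_conv Suc)
qed

lemma degree_alt_weight: "degree (alt_weight m w) \<le> length w"
proof (induction m arbitrary: w)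
  case (Suc m)
  have conv: "degree (conv f g w) \<le> length w"
    if f: "\<And>u. degree (f u) \<le> length u" and g: "\<And>u. degree (g u) \<le> length u"
    for f g :: "nat list \<Rightarrow> rat poly" and w
    unfolding conv_def
  proof (rule degree_sum_le)
    fix i assume "i \<in> {..length w}"
    then show "degree (f (take i w) * g (drop i w)) \<le> length w"
      using f[of "take i w"] g[of "drop i w"] degree_mult_le[of "f (take i w)" "g (drop i w)"]
      by simp
  qed simp
  have "degree (monotone_weight R c u) \<le> length u" if "degree c \<le> 1"
    for R and c :: "rat poly" and u :: "nat list"
  proof -
    have "degree (c ^ length u) \<le> degree c * length u" by (rule degree_power_le)
    also have "\<dots> \<le> 1 * length u" using that by (rule mult_le_mono1)
    finally show ?thesis by (simp add: monotone_weight_def)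
  qed
  then show ?case
    unfolding alt_weight.simps by (intro conv Suc) simp_all
qed simp

text \<open>The contributions to \<open>alt_weight (Suc m) (x # w)\<close> of the factorizations in which \<open>x\<close> lies in
  the first decreasing block, respectively in the first increasing block.\<close>

definition neg_first :: "nat \<Rightarrow> nat \<Rightarrow> nat list \<Rightarrow> rat poly" where
  "neg_first m x = conv (\<lambda>u. monotone_weight (>) [:0, 1:] (x # u))
     (conv (monotone_weight (<) 1) (alt_weight m))"

definition pos_first :: "nat \<Rightarrow> nat \<Rightarrow> nat list \<Rightarrow> rat poly" where
  "pos_first m x = conv (\<lambda>u. monotone_weight (<) 1 (x # u)) (alt_weight m)"

lemma monotone_weight_Nil [simp]: "monotone_weight R c [] = 1"
  by (simp add: monotone_weight_def)

lemma monotone_weight_Cons2: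
  "transp R \<Longrightarrow> monotone_weight R c (x # z # u) =
     (if R x z then c * monotone_weight R c (z # u) else 0)"
  by (auto simp: monotone_weight_def dest: transpD)

lemma alt_weight_Nil [simp]: "alt_weight m [] = 1"
  by (induction m) (simp_all add: conv_Nil)

lemma conv_increasing_Cons:
  "conv (monotone_weight (<) 1) (alt_weight m) (x # w) = alt_weight m (x # w) + pos_first m x w"
  by (simp add: conv_Cons pos_first_def)

lemma alt_weight_Suc_Cons:
  "alt_weight (Suc m) (x # w) = alt_weight m (x # w) + pos_first m x w + neg_first m x w"
  by (simp add: conv_Cons conv_increasing_Cons[unfolded conv_Cons] neg_first_def pos_first_def)

lemma pos_first_Nil: "pos_first m x [] = 1"
  by (simp add: pos_first_def conv_Nil monotone_weight_def)

lemma neg_first_Nil: "neg_first m x [] = [:0, 1:]"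
  by (simp add: neg_first_def conv_Nil monotone_weight_def)

lemma conv_cmult_left: "conv (\<lambda>u. c * f u) g w = c * conv f g w"
  by (simp add: conv_def sum_distrib_left mult.assoc)

lemma conv_0_left: "conv (\<lambda>_. 0) g w = 0"
  by (simp add: conv_def)

text \<open>Either the increasing block of \<open>x\<close> ends with \<open>x\<close>, and the rest is factored freely into the
  remaining \<open>m\<close> pairs, or it continues with \<open>z\<close>.\<close>

lemma pos_first_Cons:
  "pos_first m x (z # w) = alt_weight m (z # w) + (if x < z then pos_first m z w else 0)"
proof -
  have "transp ((<) :: nat \<Rightarrow> _)" by (auto simp: transp_def)
  then show ?thesis
    unfolding pos_first_def
    by (subst conv_Cons) (auto simp: monotone_weight_Cons2 conv_0_left monotone_weight_def[of _ _ "[x]"])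
qed

text \<open>As for \<open>pos_first_Cons\<close>, but after a decreasing block that ends with \<open>x\<close> the increasing
  block of the same pair is still to come, so \<open>z\<close> may lie in it.\<close>

lemma neg_first_Cons:
  "neg_first m x (z # w) = [:0, 1:] * (alt_weight m (z # w) + pos_first m z w)
     + (if x > z then [:0, 1:] * neg_first m z w else 0)"
proof -
  have "transp ((>) :: nat \<Rightarrow> _)" by (auto simp: transp_def)
  then show ?thesis
    unfolding neg_first_def
    by (subst conv_Cons)
       (auto simp: monotone_weight_Cons2 conv_0_left conv_cmult_left conv_increasing_Cons
         monotone_weight_def[of _ _ "[x]"] simp del: mult_pCons_left)
qed

definition genfun :: "(nat \<Rightarrow> rat poly) \<Rightarrow> lau" where
  "genfun f = fps_to_fls (Abs_fps (\<lambda>m. to_fract (f m)))"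

lemma genfun_add: "genfun (\<lambda>m. f m + g m) = genfun f + genfun g"
  by (simp add: genfun_def fls_eq_iff)

lemma genfun_sum: "genfun (\<lambda>m. \<Sum>i\<in>I. f i m) = (\<Sum>i\<in>I. genfun (f i))"
proof (induction I rule: infinite_finite_induct)
  case (insert x F)
  then show ?case by (simp add: genfun_add)
qed (simp_all add: genfun_def fls_eq_iff)

lemma genfun_y: "genfun (\<lambda>m. [:0, 1:] * f m) = yvar * genfun f"
proof -
  have "genfun (\<lambda>m. c * f m) = fls_const (to_fract c) * genfun f" for c
    by (simp add: genfun_def fls_eq_iff)
  then show ?thesis unfolding yvar_def by blast
qed

lemma genfun_shift: "genfun f = fls_const (to_fract (f 0)) + tvar * genfun (\<lambda>m. f (Suc m))"
proof (rule fls_eqI)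
  fix i :: int
  show "fls_nth (genfun f) i =
     fls_nth (fls_const (to_fract (f 0)) + tvar * genfun (\<lambda>m. f (Suc m))) i"
    by (cases "i \<le> 0")
       (auto simp: genfun_def tvar_def fls_X_times_conv_shift nat_diff_distrib
         Suc_nat_eq_nat_zadd1 nat_eq_iff2 simp flip: Suc_diff_1)
qed

lemma genfun_inject: "genfun f = genfun g \<longleftrightarrow> f = g"
  by (auto simp: genfun_def fps_eq_iff fun_eq_iff)


definition des :: "nat list \<Rightarrow> nat" where
  "des w = (\<Sum>i<length w - 1. of_bool (w ! i > w ! Suc i))"

definition pk :: "nat list \<Rightarrow> nat" where
  "pk w = (\<Sum>i<length w - 2. of_bool (w ! i < w ! Suc i \<and> w ! Suc i > w ! Suc (Suc i)))"

lemma des_single: "des [x] = 0"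
  by (simp add: des_def)

lemma des_Cons2: "des (x # z # w) = of_bool (x > z) + des (z # w)"
  by (simp add: des_def sum.lessThan_Suc_shift del: sum.lessThan_Suc)

lemma pk_single: "pk [x] = 0"
  by (simp add: pk_def)

lemma pk_double: "pk [x, z] = 0"
  by (simp add: pk_def)

lemma pk_Cons3: "pk (x # z # z' # w) = of_bool (x < z \<and> z > z') + pk (z # z' # w)"
  by (simp add: pk_def sum.lessThan_Suc_shift del: sum.lessThan_Suc)

text \<open>The coefficient of \<open>x^n\<close> in \<open>u\<close>.\<close>

definition ucoeff :: "nat \<Rightarrow> int \<Rightarrow> int \<Rightarrow> lau" where
  "ucoeff n j k = tvar powi (j + 1) * (yvar + tvar) powi (k - j)
     * (1 + yvar * tvar) powi (int n - j - k - 1)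
     * (1 + yvar) powi (2 * j + 1) / (1 - tvar) ^ (n + 1)"

lemma useries_eq: "useries n j k = monom (ucoeff n j k) n"
  by (simp add: useries_def ucoeff_def)

lemma basic_series_nonzero:
  "tvar \<noteq> 0" "yvar + tvar \<noteq> 0" "1 + yvar * tvar \<noteq> 0" "1 + yvar \<noteq> 0" "1 - tvar \<noteq> 0"
proof -
  have y1: "to_fract [:0, 1:] + 1 \<noteq> (0 :: rat poly fract)"
    by (simp flip: to_fract_add to_fract_1 add: one_pCons)
  have "fls_nth tvar 1 \<noteq> 0" "fls_nth (yvar + tvar) 1 \<noteq> 0" "fls_nth (1 + yvar * tvar) 0 \<noteq> 0"
    "fls_nth (1 + yvar) 0 \<noteq> 0" "fls_nth (1 - tvar) 0 \<noteq> 0"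
    using y1 by (simp_all add: tvar_def yvar_def fls_times_both_shifted_simp add.commute)
  then show "tvar \<noteq> 0" "yvar + tvar \<noteq> 0" "1 + yvar * tvar \<noteq> 0" "1 + yvar \<noteq> 0" "1 - tvar \<noteq> 0"
    by (metis fls_zero_nth)+
qed

lemma ucoeff_Suc_mult:
  "ucoeff (Suc n) j k * (1 - tvar) = tvar powi (j + 1) * (yvar + tvar) powi (k - j)
     * (1 + yvar * tvar) powi (int n - j - k) * (1 + yvar) powi (2 * j + 1) / (1 - tvar) ^ (n + 1)"
proof -
  have "a / (r * p) * r = a / p" if "r \<noteq> 0" for a r p :: lau
    using that by simp
  moreover have "int (Suc n) - j - k - 1 = int n - j - k" by simp
  ultimately show ?thesis
    unfolding ucoeff_def using basic_series_nonzero(5) by (simp only: add_Suc power_Suc)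
qed

text \<open>The three ways in which a letter put in front changes \<open>u\<close>: it adds an ascent without a peak,
  a descent, or an ascent together with a peak.\<close>

lemma ucoeff_ascent: "ucoeff (Suc n) j k * (1 - tvar) = ucoeff n j k * (1 + yvar * tvar)"
proof -
  have "(1 + yvar * tvar) powi (int n - j - k) =
      (1 + yvar * tvar) powi (int n - j - k - 1) * (1 + yvar * tvar)"
    using power_int_add_1[of "1 + yvar * tvar" "int n - j - k - 1"] basic_series_nonzero(3) by simp
  then show ?thesis
    by (simp only: ucoeff_Suc_mult) (simp add: ucoeff_def mult_ac)
qed

lemma ucoeff_descent: "ucoeff (Suc n) j (k + 1) * (1 - tvar) = ucoeff n j k * (yvar + tvar)"
proof -
  have "(yvar + tvar) powi (k + 1 - j) = (yvar + tvar) powi (k - j) * (yvar + tvar)"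
    using power_int_add_1[of "yvar + tvar" "k - j"] basic_series_nonzero(2) by (simp add: algebra_simps)
  moreover have "int n - j - (k + 1) = int n - j - k - 1" by simp
  ultimately show ?thesis
    by (simp only: ucoeff_Suc_mult) (simp add: ucoeff_def mult_ac)
qed

lemma ucoeff_peak:
  "ucoeff (Suc n) (j + 1) k * (1 - tvar) * (yvar + tvar) = ucoeff n j k * tvar * (1 + yvar) ^ 2"
proof -
  have "(yvar + tvar) powi (k - j) = (yvar + tvar) powi (k - (j + 1)) * (yvar + tvar)"
    using power_int_add_1[of "yvar + tvar" "k - (j + 1)"] basic_series_nonzero(2) by (simp add: algebra_simps)
  moreover have "int n - (j + 1) - k = int n - j - k - 1" by simp
  moreover have "(1 + yvar) powi (2 * (j + 1) + 1) = (1 + yvar) powi (2 * j + 1) * (1 + yvar) ^ 2"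
    using power_int_add[of "1 + yvar" "2 * j + 1" 2] basic_series_nonzero(4) by (simp add: algebra_simps)
  moreover have "tvar powi (j + 1 + 1) = tvar powi (j + 1) * tvar"
    using power_int_add_1[of tvar "j + 1"] basic_series_nonzero(1) by simp
  ultimately show ?thesis
    by (simp only: ucoeff_Suc_mult) (simp add: ucoeff_def mult_ac)
qed

lemma genfun_const: "genfun (\<lambda>_. c) * (1 - tvar) = fls_const (to_fract c)"
  using genfun_shift[of "\<lambda>_. c"] by (simp add: algebra_simps)

lemma genfun_alt_weight_Cons:
  "genfun (\<lambda>m. alt_weight m (x # w)) * (1 - tvar) =
     tvar * (genfun (\<lambda>m. pos_first m x w) + genfun (\<lambda>m. neg_first m x w))"
  using genfun_shift[of "\<lambda>m. alt_weight m (x # w)"]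
  by (simp add: alt_weight_Suc_Cons genfun_add algebra_simps del: alt_weight.simps(2))

text \<open>One letter is added in front at a time. Besides the series itself the induction records
  which share of it has the first letter in an increasing block. This share depends only on
  whether the word starts with a descent, and it decides the factor contributed by the next
  letter in front.\<close>

lemma genfun_alt_weight_aux:
  assumes "distinct (x # w)"
  shows "genfun (\<lambda>m. alt_weight m (x # w)) =
           ucoeff (length (x # w)) (int (pk (x # w))) (int (des (x # w))) \<and>
         (if w \<noteq> [] \<and> x > hd w
          then (yvar + tvar) * genfun (\<lambda>m. pos_first m x w) =
                 tvar * (genfun (\<lambda>m. pos_first m x w) + genfun (\<lambda>m. neg_first m x w))
          else (1 + yvar) * genfun (\<lambda>m. pos_first m x w) =
                 genfun (\<lambda>m. pos_first m x w) + genfun (\<lambda>m. neg_first m x w))"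
  using assms
proof (induction w arbitrary: x)
  case Nil
  let ?A = "genfun (\<lambda>m. alt_weight m [x])"
  let ?P = "genfun (\<lambda>m. pos_first m x [])" and ?N = "genfun (\<lambda>m. neg_first m x [])"
  have P: "?P * (1 - tvar) = 1" and N: "?N * (1 - tvar) = yvar"
    by (simp_all add: pos_first_Nil neg_first_Nil genfun_const yvar_def)
  have "(1 + yvar) * ?P * (1 - tvar) = (?P + ?N) * (1 - tvar)"
    by (simp only: mult.assoc P distrib_right N) simp
  then have PN: "(1 + yvar) * ?P = ?P + ?N" using basic_series_nonzero(5) by simp
  have "?A * (1 - tvar) * (1 - tvar) = tvar * (?P * (1 - tvar) + ?N * (1 - tvar))"
    by (simp only: genfun_alt_weight_Cons) (simp add: algebra_simps)
  also have "\<dots> = tvar * (1 + yvar)" by (simp only: P N)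
  also have "\<dots> = ucoeff 1 0 0 * (1 - tvar) * (1 - tvar)"
    using basic_series_nonzero(5) by (simp add: ucoeff_def)
  finally have "?A = ucoeff 1 0 0" using basic_series_nonzero(5) by simp
  with PN show ?case by (simp add: pk_single des_single)
next
  case (Cons z w)
  let ?n = "length (z # w)" and ?j = "int (pk (z # w))" and ?k = "int (des (z # w))"
  let ?A' = "genfun (\<lambda>m. alt_weight m (x # z # w))" and ?A = "genfun (\<lambda>m. alt_weight m (z # w))"
  let ?P' = "genfun (\<lambda>m. pos_first m x (z # w))" and ?N' = "genfun (\<lambda>m. neg_first m x (z # w))"
  let ?P = "genfun (\<lambda>m. pos_first m z w)" and ?N = "genfun (\<lambda>m. neg_first m z w)"
  have IH: "?A = ucoeff ?n ?j ?k"
    "if w \<noteq> [] \<and> z > hd w then (yvar + tvar) * ?P = tvar * (?P + ?N)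
     else (1 + yvar) * ?P = ?P + ?N"
    using Cons.IH[of z] Cons.prems by auto
  have A: "?A * (1 - tvar) = tvar * (?P + ?N)" and A': "?A' * (1 - tvar) = tvar * (?P' + ?N')"
    by (rule genfun_alt_weight_Cons)+
  show ?case
  proof (cases "x < z")
    case True
    \<comment> \<open>Since \<open>x < z\<close>, a decreasing block containing \<open>x\<close> ends with it.\<close>
    have P': "?P' = ?A + ?P" and N': "?N' = yvar * (?A + ?P)"
      using True by (simp_all only: pos_first_Cons neg_first_Cons genfun_add[symmetric]
          genfun_y[symmetric]) simp_all
    have PN: "(1 + yvar) * ?P' = ?P' + ?N'"
      by (simp add: P' N' algebra_simps)
    have "?A' = ucoeff (Suc ?n) (int (pk (x # z # w))) ?k"
    proof (cases "w \<noteq> [] \<and> z > hd w")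
      case False
      have "?A' * (1 - tvar) = tvar * (1 + yvar) * ?A + tvar * ((1 + yvar) * ?P)"
        unfolding A' P' N' by (simp add: algebra_simps)
      also have "tvar * ((1 + yvar) * ?P) = ?A * (1 - tvar)"
        unfolding A using IH(2) False by (simp only: if_False)
      also have "tvar * (1 + yvar) * ?A + ?A * (1 - tvar) = ?A * (1 + yvar * tvar)"
        by (simp add: algebra_simps)
      also have "\<dots> = ucoeff (Suc ?n) ?j ?k * (1 - tvar)"
        by (simp only: IH(1) ucoeff_ascent)
      finally have "?A' = ucoeff (Suc ?n) ?j ?k" using basic_series_nonzero(5) by simp
      moreover have "pk (x # z # w) = pk (z # w)"
        using False by (cases w) (auto simp: pk_Cons3 pk_single pk_double)
      ultimately show ?thesis by simp
    next
      case desc: True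
      have "?A' * (1 - tvar) * (yvar + tvar)
          = tvar * (1 + yvar) * (?A * (yvar + tvar) + (yvar + tvar) * ?P)"
        unfolding A' P' N' by (simp add: algebra_simps)
      also have "(yvar + tvar) * ?P = ?A * (1 - tvar)"
        unfolding A using IH(2) desc by (simp only: if_True simp_thms)
      also have "tvar * (1 + yvar) * (?A * (yvar + tvar) + ?A * (1 - tvar))
          = ?A * tvar * (1 + yvar) ^ 2"
        by (simp add: algebra_simps power2_eq_square)
      also have "\<dots> = ucoeff (Suc ?n) (?j + 1) ?k * (1 - tvar) * (yvar + tvar)"
        by (simp only: IH(1) ucoeff_peak)
      finally have "?A' = ucoeff (Suc ?n) (?j + 1) ?k" using basic_series_nonzero(2,5) by simp
      moreover have "int (pk (x # z # w)) = ?j + 1"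
        using desc True by (cases w) (auto simp: pk_Cons3)
      ultimately show ?thesis by simp
    qed
    with PN True show ?thesis by (simp add: des_Cons2)
  next
    case False
    with Cons.prems have False: "x > z" by auto
    \<comment> \<open>Since \<open>x > z\<close>, an increasing block containing \<open>x\<close> ends with it.\<close>
    have P': "?P' = ?A" and N': "?N' = yvar * (?A + ?P + ?N)"
      using False by (simp_all only: pos_first_Cons neg_first_Cons genfun_add[symmetric]
          genfun_y[symmetric]) (simp_all add: algebra_simps)
    have "tvar * (?P' + ?N') = tvar * (1 + yvar) * ?A + yvar * (tvar * (?P + ?N))"
      unfolding P' N' by (simp add: algebra_simps)
    also have "\<dots> = (yvar + tvar) * ?A"
      unfolding A[symmetric] by (simp add: algebra_simps)
    finally have *: "tvar * (?P' + ?N') = (yvar + tvar) * ?A" .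
    have "?A' * (1 - tvar) = ?A * (yvar + tvar)"
      unfolding A' * by (simp add: mult.commute)
    also have "\<dots> = ucoeff (Suc ?n) ?j (?k + 1) * (1 - tvar)"
      by (simp only: IH(1) ucoeff_descent)
    finally have "?A' = ucoeff (Suc ?n) ?j (?k + 1)" using basic_series_nonzero(5) by simp
    moreover have "pk (x # z # w) = pk (z # w)"
      using False by (cases w) (auto simp: pk_Cons3 pk_single pk_double)
    moreover have "(yvar + tvar) * ?P' = tvar * (?P' + ?N')"
      by (simp only: *) (simp only: P')
    ultimately show ?thesis using False by (simp add: des_Cons2 add.commute)
  qed
qed

lemma genfun_alt_weight:
  assumes "distinct w" "w \<noteq> []"
  shows "genfun (\<lambda>m. alt_weight m w) = ucoeff (length w) (int (pk w)) (int (des w))"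
  using assms genfun_alt_weight_aux by (cases w) auto

section \<open>Cyclic shuffles as unions of linear shuffles\<close>

lemma cyc_memI: "rotate k \<pi> \<in> cyc \<pi>"
  by (auto simp: cyc_def)

lemma self_in_cyc: "\<pi> \<in> cyc \<pi>"
  using cyc_memI[of 0] by simp

lemma cyc_eq:
  assumes "\<rho> \<in> cyc \<pi>"
  shows "cyc \<rho> = cyc \<pi>"
proof -
  have sub: "cyc (rotate k \<sigma>) \<subseteq> cyc \<sigma>" for k \<sigma>
    by (auto simp: cyc_def rotate_rotate)
  from assms obtain k where k: "\<rho> = rotate k \<pi>" by (auto simp: cyc_def)
  have "\<pi> = rotate (length \<pi> - k mod length \<pi>) \<rho>"
  proof (cases "\<pi> = []")
    case False
    have "(length \<pi> - k mod length \<pi> + k) mod length \<pi> = 0"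
    proof -
      have "(length \<pi> - k mod length \<pi> + k) mod length \<pi> =
          (length \<pi> - k mod length \<pi> + k mod length \<pi>) mod length \<pi>"
        by (simp add: mod_simps)
      also have "length \<pi> - k mod length \<pi> + k mod length \<pi> = length \<pi>"
        using False by (simp add: less_imp_le_nat)
      finally show ?thesis by simp
    qed
    then show ?thesis
      unfolding k rotate_rotate by (rule rotate_id[symmetric])
  qed (simp add: k)
  then have "cyc \<pi> \<subseteq> cyc \<rho>" using sub by metis
  with sub k show ?thesis by blast
qed

lemma filter_rotate_in_cyc: "filter P (rotate k w) \<in> cyc (filter P w)"
proof (induction k)
  case (Suc k)
  have "filter P (rotate1 u) \<in> cyc (filter P u)" for u
    using cyc_memI[of 1 "filter P u"] by (cases u) (auto simp: self_in_cyc)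
  from this[of "rotate k w"] Suc show ?case
    by (simp add: cyc_eq)
qed (simp add: self_in_cyc)

lemma filter_subseq:
  assumes "subseq v u" "distinct u"
  shows "filter (\<lambda>x. x \<in> set v) u = v"
proof -
  have "subseq (filter (\<lambda>x. x \<in> set v) v) (filter (\<lambda>x. x \<in> set v) u)"
    using assms(1) by (rule subseq_filter)
  moreover have "length v = length (filter (\<lambda>x. x \<in> set v) u)"
  proof -
    have "set v \<subseteq> set u" using assms(1) by (auto dest: list_emb_set)
    then have "set (filter (\<lambda>x. x \<in> set v) u) = set v" by auto
    moreover have "distinct v" using assms by (auto simp: subseq_conv_nths intro: distinct_nthsI)
    ultimately show ?thesis using assms(2) by (metis distinct_card distinct_filter)
  qed
  ultimately show ?thesis by (metis filter_True subseq_same_length)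
qed

lemma Sh_iff:
  assumes "disjoint_perms \<pi> \<sigma>"
  shows "\<tau> \<in> Sh \<pi> \<sigma> \<longleftrightarrow> distinct \<tau> \<and> set \<tau> = set \<pi> \<union> set \<sigma> \<and>
     filter (\<lambda>x. x \<in> set \<pi>) \<tau> = \<pi> \<and> filter (\<lambda>x. x \<in> set \<sigma>) \<tau> = \<sigma>"
proof
  assume "\<tau> \<in> Sh \<pi> \<sigma>"
  with Sh_set[OF assms this] show "distinct \<tau> \<and> set \<tau> = set \<pi> \<union> set \<sigma> \<and>
     filter (\<lambda>x. x \<in> set \<pi>) \<tau> = \<pi> \<and> filter (\<lambda>x. x \<in> set \<sigma>) \<tau> = \<sigma>"
    by (auto simp: Sh_def is_perm_def filter_subseq)
next
  assume *: "distinct \<tau> \<and> set \<tau> = set \<pi> \<union> set \<sigma> \<and>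
     filter (\<lambda>x. x \<in> set \<pi>) \<tau> = \<pi> \<and> filter (\<lambda>x. x \<in> set \<sigma>) \<tau> = \<sigma>"
  then have "length \<tau> = length \<pi> + length \<sigma>"
    using assms
    by (metis card_Un_disjoint disjoint_perms_def distinct_card is_perm_def List.finite_set)
  moreover have "subseq \<pi> \<tau>" "subseq \<sigma> \<tau>" using * by (metis subseq_filter_left)+
  ultimately show "\<tau> \<in> Sh \<pi> \<sigma>"
    using * assms by (auto simp: Sh_def is_perm_def disjoint_perms_def)
qed

lemma Sh_eq_shuffles:
  assumes "disjoint_perms \<pi> \<sigma>"
  shows "Sh \<pi> \<sigma> = shuffles \<pi> \<sigma>"
proof (intro equalityI subsetI)
  fix \<tau> assume "\<tau> \<in> Sh \<pi> \<sigma>"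
  then have *: "set \<tau> = set \<pi> \<union> set \<sigma>" "filter (\<lambda>x. x \<in> set \<pi>) \<tau> = \<pi>"
    "filter (\<lambda>x. x \<in> set \<sigma>) \<tau> = \<sigma>"
    unfolding Sh_iff[OF assms] by blast+
  have "filter (\<lambda>x. x \<notin> set \<pi>) \<tau> = filter (\<lambda>x. x \<in> set \<sigma>) \<tau>"
    using *(1) assms by (intro filter_cong) (auto simp: disjoint_perms_def)
  then show "\<tau> \<in> shuffles \<pi> \<sigma>"
    using partition_in_shuffles[of \<tau> "\<lambda>x. x \<in> set \<pi>"] *(2,3) by (simp only:)
next
  fix \<tau> assume \<tau>: "\<tau> \<in> shuffles \<pi> \<sigma>"
  have disj: "set \<pi> \<inter> set \<sigma> = {}" "distinct \<pi>" "distinct \<sigma>"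
    using assms by (auto simp: disjoint_perms_def is_perm_def)
  have set: "set \<tau> = set \<pi> \<union> set \<sigma>" using \<tau> by (rule set_shuffles)
  have "filter (\<lambda>x. x \<in> set \<sigma>) \<tau> = filter (\<lambda>x. x \<notin> set \<pi>) \<tau>"
    using set disj by (intro filter_cong) auto
  then have "filter (\<lambda>x. x \<in> set \<sigma>) \<tau> = \<sigma>"
    using filter_shuffles_disjoint1(2)[OF disj(1) \<tau>] by (simp only:)
  then show "\<tau> \<in> Sh \<pi> \<sigma>"
    unfolding Sh_iff[OF assms]
    using set filter_shuffles_disjoint1(1)[OF disj(1) \<tau>] distinct_disjoint_shuffles[OF disj(2,3,1) \<tau>]
    by blast
qed

lemma disjoint_perms_rotations:
  assumes "disjoint_perms \<pi> \<sigma>" "\<rho> \<in> cyc \<pi>" "\<rho>' \<in> cyc \<sigma>"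
  shows "disjoint_perms \<rho> \<rho>'" "set \<rho> = set \<pi>" "set \<rho>' = set \<sigma>"
  using assms by (auto simp: cyc_def disjoint_perms_def is_perm_def)

text \<open>A rotation of a shuffle of \<open>\<rho>\<close> and \<open>\<rho>'\<close> is a shuffle of rotations of \<open>\<rho>\<close> and \<open>\<rho>'\<close>, because
  filtering a rotated word rotates the filtered word.\<close>

lemma Union_cSh:
  assumes "disjoint_perms \<pi> \<sigma>"
  shows "\<Union>(cSh (cyc \<pi>) (cyc \<sigma>)) = (\<Union>(\<rho>, \<rho>')\<in>cyc \<pi> \<times> cyc \<sigma>. Sh \<rho> \<rho>')"
proof (intro equalityI subsetI)
  fix \<tau> assume "\<tau> \<in> \<Union>(cSh (cyc \<pi>) (cyc \<sigma>))"
  then obtain \<tau>0 \<rho> \<rho>' where *: "\<tau> \<in> cyc \<tau>0" "\<rho> \<in> cyc \<pi>" "\<rho>' \<in> cyc \<sigma>" "\<tau>0 \<in> Sh \<rho> \<rho>'"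
    by (auto simp: cSh_def)
  note d = disjoint_perms_rotations[OF assms *(2,3)]
  from * obtain k where k: "\<tau> = rotate k \<tau>0" by (auto simp: cyc_def)
  define r r' where "r = filter (\<lambda>x. x \<in> set \<pi>) \<tau>" and "r' = filter (\<lambda>x. x \<in> set \<sigma>) \<tau>"
  have \<tau>0: "distinct \<tau>0" "set \<tau>0 = set \<pi> \<union> set \<sigma>"
    "filter (\<lambda>x. x \<in> set \<pi>) \<tau>0 = \<rho>" "filter (\<lambda>x. x \<in> set \<sigma>) \<tau>0 = \<rho>'"
    using *(4) unfolding Sh_iff[OF d(1)] d(2,3) by blast+
  have r: "r \<in> cyc \<pi>" "r' \<in> cyc \<sigma>"
    using filter_rotate_in_cyc[of "\<lambda>x. x \<in> set \<pi>" k \<tau>0] filter_rotate_in_cyc[of "\<lambda>x. x \<in> set \<sigma>" k \<tau>0]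
    unfolding \<tau>0 cyc_eq[OF *(2)] cyc_eq[OF *(3)] r_def r'_def k by blast+
  note d' = disjoint_perms_rotations[OF assms r]
  have "\<tau> \<in> Sh r r'"
    unfolding Sh_iff[OF d'(1)] d'(2,3) using \<tau>0(1,2) by (simp add: k r_def r'_def)
  with r show "\<tau> \<in> (\<Union>(\<rho>, \<rho>')\<in>cyc \<pi> \<times> cyc \<sigma>. Sh \<rho> \<rho>')" by blast
next
  fix \<tau> assume "\<tau> \<in> (\<Union>(\<rho>, \<rho>')\<in>cyc \<pi> \<times> cyc \<sigma>. Sh \<rho> \<rho>')"
  then show "\<tau> \<in> \<Union>(cSh (cyc \<pi>) (cyc \<sigma>))"
    using self_in_cyc unfolding cSh_def by blast
qed

text \<open>Both sides are sums over disjoint unions: distinct cyclic permutations share no word, and a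
  shuffle determines the two words it was made of.\<close>

lemma sum_cSh:
  fixes f :: "nat list \<Rightarrow> 'b::comm_monoid_add"
  assumes "disjoint_perms \<pi> \<sigma>"
  shows "(\<Sum>T\<in>cSh (cyc \<pi>) (cyc \<sigma>). sum f T) = (\<Sum>\<rho>\<in>cyc \<pi>. \<Sum>\<rho>'\<in>cyc \<sigma>. sum f (Sh \<rho> \<rho>'))"
proof -
  have "(\<Sum>T\<in>cSh (cyc \<pi>) (cyc \<sigma>). sum f T) = sum f (\<Union>(cSh (cyc \<pi>) (cyc \<sigma>)))"
  proof (subst sum.Union_disjoint)
    show "\<forall>A\<in>cSh (cyc \<pi>) (cyc \<sigma>). finite A"
      by (auto simp: cSh_def finite_cyc)
    show "\<forall>A\<in>cSh (cyc \<pi>) (cyc \<sigma>). \<forall>B\<in>cSh (cyc \<pi>) (cyc \<sigma>). A \<noteq> B \<longrightarrow> A \<inter> B = {}"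
    proof (intro ballI impI)
      fix A B assume "A \<in> cSh (cyc \<pi>) (cyc \<sigma>)" "B \<in> cSh (cyc \<pi>) (cyc \<sigma>)" and "A \<noteq> B"
      then obtain a b where "A = cyc a" "B = cyc b" by (auto simp: cSh_def)
      with \<open>A \<noteq> B\<close> show "A \<inter> B = {}" using cyc_eq by blast
    qed
  qed simp
  also have "\<dots> = (\<Sum>(\<rho>, \<rho>')\<in>cyc \<pi> \<times> cyc \<sigma>. sum f (Sh \<rho> \<rho>'))"
    unfolding Union_cSh[OF assms]
  proof (subst sum.UNION_disjoint)
    show "finite (cyc \<pi> \<times> cyc \<sigma>)" by (simp add: finite_cyc)
    show "\<forall>i\<in>cyc \<pi> \<times> cyc \<sigma>. finite (case i of (\<rho>, \<rho>') \<Rightarrow> Sh \<rho> \<rho>')"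
      using disjoint_perms_rotations(1)[OF assms] by (auto simp: Sh_eq_shuffles)
    show "\<forall>i\<in>cyc \<pi> \<times> cyc \<sigma>. \<forall>j\<in>cyc \<pi> \<times> cyc \<sigma>. i \<noteq> j \<longrightarrow>
        (case i of (\<rho>, \<rho>') \<Rightarrow> Sh \<rho> \<rho>') \<inter> (case j of (\<rho>, \<rho>') \<Rightarrow> Sh \<rho> \<rho>') = {}"
    proof (intro ballI impI)
      fix p q assume pq: "p \<in> cyc \<pi> \<times> cyc \<sigma>" "q \<in> cyc \<pi> \<times> cyc \<sigma>" "p \<noteq> q"
      have "p = (filter (\<lambda>x. x \<in> set \<pi>) \<tau>, filter (\<lambda>x. x \<in> set \<sigma>) \<tau>)"
        if "p \<in> cyc \<pi> \<times> cyc \<sigma>" "\<tau> \<in> (case p of (\<rho>, \<rho>') \<Rightarrow> Sh \<rho> \<rho>')" for p \<tau>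
      proof -
        obtain \<rho> \<rho>' where p: "p = (\<rho>, \<rho>')" by (cases p)
        with that have *: "\<rho> \<in> cyc \<pi>" "\<rho>' \<in> cyc \<sigma>" "\<tau> \<in> Sh \<rho> \<rho>'" by auto
        note d = disjoint_perms_rotations[OF assms *(1,2)]
        from *(3) show ?thesis unfolding p Sh_iff[OF d(1)] d(2,3) by blast
      qed
      with pq show "(case p of (\<rho>, \<rho>') \<Rightarrow> Sh \<rho> \<rho>') \<inter> (case q of (\<rho>, \<rho>') \<Rightarrow> Sh \<rho> \<rho>') = {}"
        by blast
    qed
  qed (auto intro!: sum.cong)
  also have "\<dots> = (\<Sum>\<rho>\<in>cyc \<pi>. \<Sum>\<rho>'\<in>cyc \<sigma>. sum f (Sh \<rho> \<rho>'))"
    by (simp add: sum.cartesian_product)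
  finally show ?thesis .
qed

definition cyc_weight :: "nat \<Rightarrow> cperm \<Rightarrow> rat poly" where
  "cyc_weight m C = (\<Sum>\<rho>\<in>C. alt_weight m \<rho>)"

lemma cyc_weight_mult:
  assumes "disjoint_perms \<pi> \<sigma>"
  shows "(\<Sum>T\<in>cSh (cyc \<pi>) (cyc \<sigma>). cyc_weight m T) = cyc_weight m (cyc \<pi>) * cyc_weight m (cyc \<sigma>)"
proof -
  have "sum (alt_weight m) (Sh \<rho> \<rho>') = alt_weight m \<rho> * alt_weight m \<rho>'"
    if "\<rho> \<in> cyc \<pi>" "\<rho>' \<in> cyc \<sigma>" for \<rho> \<rho>'
  proof -
    have d: "disjoint_perms \<rho> \<rho>'" by (rule disjoint_perms_rotations(1)[OF assms that])
    then have "shuffle_sum (alt_weight m) \<rho> \<rho>' = alt_weight m \<rho> * alt_weight m \<rho>'"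
      using shuffle_mult_alt_weight by (auto simp: shuffle_mult_def disjoint_perms_def)
    with d show ?thesis
      by (simp add: Sh_eq_shuffles shuffle_sum_eq_sum_shuffles disjoint_perms_def)
  qed
  then show ?thesis
    unfolding cyc_weight_def sum_cSh[OF assms] by (simp add: sum_product)
qed

lemma cyc_eq_image: "\<pi> \<noteq> [] \<Longrightarrow> cyc \<pi> = (\<lambda>k. rotate k \<pi>) ` {..<length \<pi>}"
proof (intro equalityI subsetI)
  fix \<rho> assume "\<pi> \<noteq> []" "\<rho> \<in> cyc \<pi>"
  then obtain k where "\<rho> = rotate k \<pi>" by (auto simp: cyc_def)
  with \<open>\<pi> \<noteq> []\<close> have "\<rho> = rotate (k mod length \<pi>) \<pi>" "k mod length \<pi> < length \<pi>"
    using rotate_conv_mod[of k \<pi>] by auto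
  then show "\<rho> \<in> (\<lambda>k. rotate k \<pi>) ` {..<length \<pi>}" by blast
qed (auto simp: cyc_def)

lemma inj_on_rotate:
  assumes "distinct \<pi>"
  shows "inj_on (\<lambda>k. rotate k \<pi>) {..<length \<pi>}"
proof (rule inj_onI)
  fix k l assume *: "k \<in> {..<length \<pi>}" "l \<in> {..<length \<pi>}" "rotate k \<pi> = rotate l \<pi>"
  have "rotate i \<pi> ! 0 = \<pi> ! i" if "i < length \<pi>" for i
    using that by (subst nth_rotate) auto
  then have "\<pi> ! k = \<pi> ! l" using * by (metis lessThan_iff)
  with * assms show "k = l" by (auto simp: nth_eq_iff_index_eq)
qed

lemma sum_cyc:
  assumes "distinct \<pi>" "\<pi> \<noteq> []"
  shows "sum f (cyc \<pi>) = (\<Sum>k<length \<pi>. f (rotate k \<pi>))"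
  using assms by (simp add: cyc_eq_image sum.reindex inj_on_rotate)

section \<open>Summing over rotations\<close>

definition desc_at :: "nat list \<Rightarrow> nat \<Rightarrow> bool" where
  "desc_at w i \<longleftrightarrow> w ! i > w ! ((i + 1) mod length w)"

definition peak_at :: "nat list \<Rightarrow> nat \<Rightarrow> bool" where
  "peak_at w i \<longleftrightarrow> w ! ((i + length w - 1) mod length w) < w ! i \<and> desc_at w i"

lemma card_less_eq_sum: "card {i::nat. i < n \<and> P i} = (\<Sum>i<n. of_bool (P i))"
proof -
  have "{..<n} \<inter> {i. P i} = {i. i < n \<and> P i}" by auto
  then show ?thesis by simp
qed

lemma cdes_eq_sum: "cdes w = (\<Sum>i<length w. of_bool (desc_at w i))"
  by (simp add: cdes_def desc_at_def card_less_eq_sum Let_def)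

lemma cpk_eq_sum: "cpk w = (\<Sum>i<length w. of_bool (peak_at w i))"
  by (simp add: cpk_def peak_at_def desc_at_def card_less_eq_sum Let_def)

lemma desc_at_rotate:
  assumes "i < length w"
  shows "desc_at (rotate k w) i = desc_at w ((k + i) mod length w)"
proof -
  have "(i + 1) mod length w < length w" using assms by (intro mod_less_divisor) linarith
  moreover have "(k + (i + 1) mod length w) mod length w = ((k + i) mod length w + 1) mod length w"
    by (simp add: mod_simps)
  ultimately show ?thesis
    using assms by (simp only: desc_at_def length_rotate nth_rotate)
qed

lemma peak_at_rotate:
  assumes "i < length w"
  shows "peak_at (rotate k w) i = peak_at w ((k + i) mod length w)"
proof -
  have "(i + length w - 1) mod length w < length w"
    using assms by (intro mod_less_divisor) linarith
  moreover have "(k + (i + length w - 1) mod length w) mod length w =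
      ((k + i) mod length w + length w - 1) mod length w"
  proof -
    have *: "a + length w - 1 = a + (length w - 1)" for a
      using assms by simp
    show ?thesis
      unfolding * by (simp add: mod_simps add.assoc)
  qed
  ultimately show ?thesis
    using assms by (simp only: peak_at_def desc_at_rotate length_rotate nth_rotate)
qed

text \<open>Cutting a cyclic word open can lose only a descent at the cut and, in \<open>cpk_eq_pk\<close>, peaks at
  the two letters next to the cut.\<close>

lemma cdes_eq_des:
  assumes "length w \<ge> 2"
  shows "cdes w = des w + of_bool (desc_at w (length w - 1))"
proof -
  obtain m where m: "length w = Suc m" "m \<ge> 1" using assms by (cases "length w") auto
  have "(\<Sum>i<m. of_bool (desc_at w i)) = (des w :: nat)"
    unfolding des_def m by (intro sum.cong) (auto simp: desc_at_def m)
  then show ?thesis by (simp add: cdes_eq_sum m)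
qed

lemma cpk_eq_pk:
  assumes "length w \<ge> 2"
  shows "cpk w = pk w + of_bool (peak_at w 0) + of_bool (peak_at w (length w - 1))"
proof -
  obtain m where m: "length w = Suc (Suc m)"
    using assms by (cases "length w"; cases "length w - 1") auto
  have "peak_at w (Suc i) \<longleftrightarrow> w ! i < w ! Suc i \<and> w ! Suc i > w ! Suc (Suc i)" if "i < m" for i
  proof -
    have "(Suc i + length w - 1) mod length w = (i + length w) mod length w" by simp
    also have "\<dots> = i" using that m by (simp only: mod_add_self2 mod_less)
    finally show ?thesis using that by (simp only: peak_at_def desc_at_def) (simp add: m)
  qed
  then have "(\<Sum>i<m. of_bool (peak_at w (Suc i))) = (pk w :: nat)"
    unfolding pk_def m by (intro sum.cong) auto
  then have "(\<Sum>i<Suc m. of_bool (peak_at w i)) = (of_bool (peak_at w 0) + pk w :: nat)"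
    by (subst sum.lessThan_Suc_shift) simp
  then show ?thesis by (simp add: cpk_eq_sum m)
qed

lemma sum_rotate_last_desc:
  "(\<Sum>k<length w. of_bool (desc_at (rotate k w) (length w - 1))) = (cdes w :: nat)"
proof -
  have "(\<Sum>k<length w. of_bool (desc_at (rotate k w) (length w - 1))) =
      (\<Sum>k<length w. of_bool (desc_at w ((length w - 1 + k) mod length w)) :: nat)"
    by (intro sum.cong) (auto simp: desc_at_rotate add.commute)
  also have "\<dots> = (\<Sum>k<length w. of_bool (desc_at w k))"
    unfolding card_less_eq_sum[symmetric] by (rule card_shift_mod)
  finally show ?thesis by (simp add: cdes_eq_sum)
qed

lemma sum_rotate_last_peak:
  "(\<Sum>k<length w. of_bool (peak_at (rotate k w) (length w - 1))) = (cpk w :: nat)"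
proof -
  have "(\<Sum>k<length w. of_bool (peak_at (rotate k w) (length w - 1))) =
      (\<Sum>k<length w. of_bool (peak_at w ((length w - 1 + k) mod length w)) :: nat)"
    by (intro sum.cong) (auto simp: peak_at_rotate add.commute)
  also have "\<dots> = (\<Sum>k<length w. of_bool (peak_at w k))"
    unfolding card_less_eq_sum[symmetric] by (rule card_shift_mod)
  finally show ?thesis by (simp add: cpk_eq_sum)
qed

lemma sum_rotate_first_peak:
  "(\<Sum>k<length w. of_bool (peak_at (rotate k w) 0)) = (cpk w :: nat)"
  unfolding cpk_eq_sum by (intro sum.cong refl) (subst peak_at_rotate, auto)

lemma last_peak_imp_desc: "peak_at w (length w - 1) \<Longrightarrow> desc_at w (length w - 1)"
  by (simp add: peak_at_def)

lemma first_peak_imp_not_desc: "w \<noteq> [] \<Longrightarrow> peak_at w 0 \<Longrightarrow> \<not> desc_at w (length w - 1)"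
  by (simp add: peak_at_def desc_at_def)

lemma cpk_le_cdes: "cpk w \<le> cdes w"
  unfolding cpk_eq_sum cdes_eq_sum by (intro sum_mono) (simp add: peak_at_def)

text \<open>A rotation that starts with a cyclic peak has an ascent from its last letter to its first,
  so no rotation is counted both in \<open>cpk\<close> and in \<open>cdes\<close>.\<close>

lemma cpk_cdes_le: "cpk w + cdes w \<le> length w"
proof (cases "w = []")
  case True
  then show ?thesis by (simp add: cpk_def cdes_def)
next
  case False
  have "cpk w + cdes w = (\<Sum>k<length w. of_bool (peak_at (rotate k w) 0)
      + of_bool (desc_at (rotate k w) (length w - 1)))"
    by (simp only: sum_rotate_last_desc sum_rotate_first_peak sum.distrib)
  also have "\<dots> \<le> (\<Sum>k<length w. 1)"
    using first_peak_imp_not_desc[of "rotate _ w"] False by (intro sum_mono) auto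
  finally show ?thesis by simp
qed

lemma cpk_pos:
  assumes "distinct w" "length w \<ge> 2"
  shows "cpk w \<ge> 1"
proof -
  obtain i where i: "i < length w" "w ! i = Max (set w)"
    using assms by (metis Max_in List.finite_set in_set_conv_nth length_0_conv not_numeral_le_zero set_empty)
  have less: "w ! j < w ! i" if "j < length w" "j \<noteq> i" for j
    using that i assms by (metis List.finite_set Max_ge le_neq_implies_less nth_eq_iff_index_eq nth_mem)
  have "(i + 1) mod length w < length w" "(i + 1) mod length w \<noteq> i"
    using i assms by (auto simp: mod_Suc)
  moreover have "(i + length w - 1) mod length w < length w" "(i + length w - 1) mod length w \<noteq> i"
    using i assms by (cases i; simp)+
  ultimately have "peak_at w i" by (simp add: peak_at_def desc_at_def less)
  then have "of_bool (peak_at w i) = (1::nat)" by simp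
  moreover have "of_bool (peak_at w i) \<le> cpk w"
    unfolding cpk_eq_sum using i by (intro member_le_sum) auto
  ultimately show ?thesis by linarith
qed

text \<open>The coefficient of \<open>x^n\<close> in \<open>v\<close>.\<close>

definition vcoeff :: "nat \<Rightarrow> int \<Rightarrow> int \<Rightarrow> lau" where
  "vcoeff n j k = of_int j * ucoeff n (j - 1) k + of_int j * ucoeff n (j - 1) (k - 1)
     + of_int (k - j) * ucoeff n j (k - 1) + of_int (int n - j - k) * ucoeff n j k"

lemma vseries_eq: "vseries n j k = monom (vcoeff n j k) n"
proof -
  have "of_int c * monom a n = monom (of_int c * a) n" for c :: int and a :: lau
    by (simp add: of_int_poly smult_monom)
  then show ?thesis
    by (simp only: vseries_def vcoeff_def useries_eq add_monom)
qed

lemma cdes_single: "cdes [x] = 0"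
  by (simp add: cdes_eq_sum desc_at_def del: sum_of_bool_eq)

lemma cpk_single: "cpk [x] = 0"
  by (simp add: cpk_eq_sum peak_at_def desc_at_def del: sum_of_bool_eq)

text \<open>The four terms of \<open>v\<close> correspond to the four kinds of places where a cyclic word can be cut
  open: before a peak, after a peak, at another descent, at another ascent.\<close>

lemma sum_rotations_ucoeff:
  assumes "w \<noteq> []"
  shows "(\<Sum>k<length w. ucoeff (length w) (int (pk (rotate k w))) (int (des (rotate k w)))) =
     vcoeff (length w) (int (cpk w)) (int (cdes w))"
proof (cases "length w \<ge> 2")
  case False
  with assms obtain x where "w = [x]" by (cases w rule: remdups_adj.cases) auto
  then show ?thesis by (simp add: vcoeff_def cpk_single cdes_single pk_single des_single)
next
  case True
  let ?n = "length w" and ?u = "ucoeff (length w)" and ?j = "int (cpk w)" and ?l = "int (cdes w)"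
  let ?a = "\<lambda>k. peak_at (rotate k w) 0" and ?b = "\<lambda>k. peak_at (rotate k w) (?n - 1)"
  let ?d = "\<lambda>k. desc_at (rotate k w) (?n - 1)"
  have "?u (int (pk (rotate k w))) (int (des (rotate k w))) =
      of_bool (?a k) * ?u (?j - 1) ?l + of_bool (?b k) * ?u (?j - 1) (?l - 1)
      + (of_bool (?d k) - of_bool (?b k)) * ?u ?j (?l - 1)
      + (1 - of_bool (?d k) - of_bool (?a k)) * ?u ?j ?l" for k
  proof -
    have "int (des (rotate k w)) = ?l - of_bool (?d k)"
      using cdes_eq_des[of "rotate k w"] True by simp
    moreover have "int (pk (rotate k w)) = ?j - of_bool (?a k) - of_bool (?b k)"
      using cpk_eq_pk[of "rotate k w"] True by simp
    moreover have "?b k \<Longrightarrow> ?d k" "?a k \<Longrightarrow> \<not> ?d k"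
      using last_peak_imp_desc[of "rotate k w"] first_peak_imp_not_desc[of "rotate k w"] assms by auto
    ultimately show ?thesis
      by (cases "?a k"; cases "?b k"; cases "?d k") auto
  qed
  then have "(\<Sum>k<?n. ?u (int (pk (rotate k w))) (int (des (rotate k w)))) =
      (\<Sum>k<?n. of_bool (?a k)) * ?u (?j - 1) ?l + (\<Sum>k<?n. of_bool (?b k)) * ?u (?j - 1) (?l - 1)
      + ((\<Sum>k<?n. of_bool (?d k)) - (\<Sum>k<?n. of_bool (?b k))) * ?u ?j (?l - 1)
      + (of_nat ?n - (\<Sum>k<?n. of_bool (?d k)) - (\<Sum>k<?n. of_bool (?a k))) * ?u ?j ?l"
    by (simp add: sum.distrib sum_subtractf sum_distrib_right left_diff_distrib)
  moreover have "(\<Sum>k<?n. of_bool (?a k)) = (of_nat (cpk w) :: lau)"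
    "(\<Sum>k<?n. of_bool (?b k)) = (of_nat (cpk w) :: lau)"
    "(\<Sum>k<?n. of_bool (?d k)) = (of_nat (cdes w) :: lau)"
    using sum_rotate_first_peak[of w, THEN arg_cong[where f = of_nat]]
      sum_rotate_last_peak[of w, THEN arg_cong[where f = of_nat]]
      sum_rotate_last_desc[of w, THEN arg_cong[where f = of_nat]]
    by (simp_all only: of_nat_sum of_nat_of_bool)
  ultimately show ?thesis
    by (simp add: vcoeff_def algebra_simps)
qed

lemma genfun_cyc_weight:
  assumes "distinct \<pi>" "\<pi> \<noteq> []"
  shows "genfun (\<lambda>m. cyc_weight m (cyc \<pi>)) = vcoeff (length \<pi>) (int (cpk \<pi>)) (int (cdes \<pi>))"
  unfolding cyc_weight_def genfun_sum sum_cyc[OF assms] sum_rotations_ucoeff[OF assms(2), symmetric]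
  using assms by (intro sum.cong) (auto simp: genfun_alt_weight)

lemma cyc_Nil: "cyc [] = {[]}"
  by (auto simp: cyc_def)

lemma genfun_cyc_weight_Nil: "genfun (\<lambda>m. cyc_weight m (cyc [])) = 1 / (1 - tvar)"
  using genfun_const[of 1] basic_series_nonzero(5) by (simp add: cyc_weight_def cyc_Nil field_simps)

section \<open>The factored form of v\<close>

text \<open>The common factor of the four terms of \<open>v\<close>.\<close>

definition vfactor :: "nat \<Rightarrow> int \<Rightarrow> int \<Rightarrow> lau" where
  "vfactor n j k = tvar powi j * (yvar + tvar) powi (k - j - 1)
     * (1 + yvar * tvar) powi (int n - j - k - 1) * (1 + yvar) powi (2 * j - 1)
     / (1 - tvar) ^ (n + 1)"

lemma ucoeff_vfactor:
  "ucoeff n (j - 1) k = (yvar + tvar) ^ 2 * (1 + yvar * tvar) * vfactor n j k"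
  "ucoeff n (j - 1) (k - 1) = (yvar + tvar) * (1 + yvar * tvar) ^ 2 * vfactor n j k"
  "ucoeff n j (k - 1) = tvar * (1 + yvar * tvar) * (1 + yvar) ^ 2 * vfactor n j k"
  "ucoeff n j k = tvar * (yvar + tvar) * (1 + yvar) ^ 2 * vfactor n j k"
proof -
  have p1: "a powi (i + 1) = a powi i * a" and p2: "a powi (i + 2) = a powi i * a ^ 2"
    if "a \<noteq> 0" for a :: lau and i
    using that by (simp_all add: power_int_add)
  have e: "j - 1 + 1 = j" "k - (j - 1) = (k - j - 1) + 2" "int n - (j - 1) - k - 1 = (int n - j - k - 1) + 1"
    "2 * (j - 1) + 1 = 2 * j - 1" "k - 1 - (j - 1) = (k - j - 1) + 1"
    "int n - (j - 1) - (k - 1) - 1 = (int n - j - k - 1) + 2" "k - 1 - j = k - j - 1"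
    "int n - j - (k - 1) - 1 = (int n - j - k - 1) + 1" "2 * j + 1 = (2 * j - 1) + 2"
    "k - j = (k - j - 1) + 1"
    by simp_all
  show "ucoeff n (j - 1) k = (yvar + tvar) ^ 2 * (1 + yvar * tvar) * vfactor n j k"
    unfolding ucoeff_def vfactor_def e(1-4) p1[OF basic_series_nonzero(3)] p2[OF basic_series_nonzero(2)] by (simp add: mult_ac)
  show "ucoeff n (j - 1) (k - 1) = (yvar + tvar) * (1 + yvar * tvar) ^ 2 * vfactor n j k"
    unfolding ucoeff_def vfactor_def e(1) e(4-6) p1[OF basic_series_nonzero(2)] p2[OF basic_series_nonzero(3)]
    by (simp add: mult_ac)
  show "ucoeff n j (k - 1) = tvar * (1 + yvar * tvar) * (1 + yvar) ^ 2 * vfactor n j k"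
    unfolding ucoeff_def vfactor_def e(7-9) p1[OF basic_series_nonzero(3)] p1[OF basic_series_nonzero(1)] p2[OF basic_series_nonzero(4)]
    by (simp add: mult_ac)
  show "ucoeff n j k = tvar * (yvar + tvar) * (1 + yvar) ^ 2 * vfactor n j k"
    using p1[OF basic_series_nonzero(2), of "k - j - 1"]
    unfolding ucoeff_def vfactor_def e(9) p1[OF basic_series_nonzero(1)] p2[OF basic_series_nonzero(4)] e(10)[symmetric]
    by (simp add: mult_ac)
qed

lemma vseries_closed_form:
  "vseries n j k = monom
       ((of_int j * (yvar + tvar) * (1 + yvar * tvar) * (1 + yvar + tvar + yvar * tvar)
           + (of_int (k - j) * (1 + yvar * tvar) + of_int (int n - j - k) * (yvar + tvar))
              * tvar * (1 + yvar) ^ 2)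
        * (tvar powi j * (yvar + tvar) powi (k - j - 1)
           * (1 + yvar * tvar) powi (int n - j - k - 1) * (1 + yvar) powi (2 * j - 1)
           / (1 - tvar) ^ (n + 1))) n"
proof -
  have "a * (p ^ 2 * q * c) + a * (p * q ^ 2 * c) + b * (t * q * r * c) + d * (t * p * r * c) =
      (a * p * q * (p + q) + (b * q + d * p) * t * r) * c" for a b c d p q r t :: lau
    by (simp add: algebra_simps power2_eq_square)
  moreover have "yvar + tvar + (1 + yvar * tvar) = 1 + yvar + tvar + yvar * tvar"
    by (simp add: algebra_simps)
  ultimately show ?thesis
    unfolding vseries_eq vcoeff_def ucoeff_vfactor[of n j k] by (simp only: vfactor_def)
qed

section \<open>Cyclic permutations in the target algebra\<close>

text \<open>The polynomial in \<open>y\<close> that is the coefficient of \<open>t^m\<close>. Since the product in \<open>t\<close> is the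
  Hadamard product, this is a ring homomorphism, and these homomorphisms together are injective.\<close>

definition coeff_at :: "nat \<Rightarrow> hps poly \<Rightarrow> rat poly" where
  "coeff_at m = map_poly (\<lambda>a. fps_nth (fps_of_hps a) m)"

lemma coeff_coeff_at: "coeff (coeff_at m p) i = fps_nth (fps_of_hps (coeff p i)) m"
  by (simp add: coeff_at_def coeff_map_poly zero_hps.rep_eq)

lemma coeff_at_eqI:
  assumes "\<And>m. coeff_at m p = coeff_at m q"
  shows "p = q"
proof (rule poly_eqI)
  fix i
  have "fps_of_hps (coeff p i) = fps_of_hps (coeff q i)"
    using assms by (metis coeff_coeff_at fps_ext)
  then show "coeff p i = coeff q i" by (simp add: fps_of_hps_inject)
qed

lemma fps_nth_hps_sum: "fps_nth (fps_of_hps (\<Sum>i\<in>I. f i)) m = (\<Sum>i\<in>I. fps_nth (fps_of_hps (f i)) m)"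
  by (induction I rule: infinite_finite_induct) (simp_all add: zero_hps.rep_eq plus_hps.rep_eq)

lemma coeff_at_sum: "coeff_at m (\<Sum>i\<in>I. f i) = (\<Sum>i\<in>I. coeff_at m (f i))"
  by (rule poly_eqI) (simp add: coeff_coeff_at coeff_sum fps_nth_hps_sum)

lemma coeff_at_mult: "coeff_at m (p * q) = coeff_at m p * coeff_at m q"
  by (rule poly_eqI) (simp add: coeff_coeff_at coeff_mult fps_nth_hps_sum times_hps.rep_eq)

lemma lau_of_eq_genfun: "lau_of p = genfun (\<lambda>m. coeff_at m p)"
  by (simp add: lau_of_def genfun_def coeff_at_def)

text \<open>An element of \<open>\<rat>[[t*]][y]\<close> with given coefficients of the powers of \<open>t\<close>. It exists
  because the degrees in \<open>y\<close> are bounded by \<open>d\<close>.\<close>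

definition interpolate :: "nat \<Rightarrow> (nat \<Rightarrow> rat poly) \<Rightarrow> hps poly" where
  "interpolate d f = (\<Sum>i\<le>d. monom (hps_of_fps (Abs_fps (\<lambda>m. coeff (f m) i))) i)"

lemma coeff_at_interpolate:
  assumes "degree (f m) \<le> d"
  shows "coeff_at m (interpolate d f) = f m"
proof (rule poly_eqI)
  fix i
  show "coeff (coeff_at m (interpolate d f)) i = coeff (f m) i"
    using assms by (auto simp: coeff_coeff_at interpolate_def coeff_sum fps_nth_hps_sum
        hps_of_fps_inverse zero_hps.rep_eq if_distrib coeff_eq_0 cong: if_cong)
qed

definition cyc_image :: "cperm \<Rightarrow> target" where
  "cyc_image C = monom (interpolate (clen C) (\<lambda>m. cyc_weight m C)) (clen C)"

lemma degree_cyc_weight: "degree (cyc_weight m (cyc \<pi>)) \<le> length \<pi>"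
  unfolding cyc_weight_def
proof (rule degree_sum_le[OF finite_cyc])
  fix \<rho> assume "\<rho> \<in> cyc \<pi>"
  then have "length \<rho> = length \<pi>" by (auto simp: cyc_def)
  then show "degree (alt_weight m \<rho>) \<le> length \<pi>" using degree_alt_weight[of m \<rho>] by simp
qed

lemma cyc_image_mult:
  assumes "disjoint_perms \<pi> \<sigma>"
  shows "cyc_image (cyc \<pi>) * cyc_image (cyc \<sigma>) = (\<Sum>T\<in>cSh (cyc \<pi>) (cyc \<sigma>). cyc_image T)"
proof -
  let ?n = "length \<pi> + length \<sigma>" and ?S = "cSh (cyc \<pi>) (cyc \<sigma>)"
  let ?c = "\<lambda>C. interpolate (clen C) (\<lambda>m. cyc_weight m C)"
  have c: "coeff_at m (?c (cyc \<tau>)) = cyc_weight m (cyc \<tau>)" for m \<tau>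
    by (rule coeff_at_interpolate) (simp add: degree_cyc_weight)
  have "?c (cyc \<pi>) * ?c (cyc \<sigma>) = (\<Sum>T\<in>?S. ?c T)"
  proof (rule coeff_at_eqI)
    fix m
    have "coeff_at m (\<Sum>T\<in>?S. ?c T) = (\<Sum>T\<in>?S. cyc_weight m T)"
      unfolding coeff_at_sum by (intro sum.cong refl) (auto simp: cSh_def c[simplified])
    then show "coeff_at m (?c (cyc \<pi>) * ?c (cyc \<sigma>)) = coeff_at m (\<Sum>T\<in>?S. ?c T)"
      unfolding coeff_at_mult c by (simp only: cyc_weight_mult[OF assms])
  qed
  moreover have "(\<Sum>T\<in>?S. cyc_image T) = monom (\<Sum>T\<in>?S. ?c T) ?n"
    unfolding monom_sum cyc_image_def by (intro sum.cong refl) (simp add: clen_cSh)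
  ultimately show ?thesis
    by (simp add: cyc_image_def mult_monom)
qed

definition perm_series :: "nat list \<Rightarrow> lau poly" where
  "perm_series \<pi> = (if length \<pi> \<ge> 1 then vseries (length \<pi>) (int (cpk \<pi>)) (int (cdes \<pi>))
     else monom (1 / (1 - tvar)) 0)"

lemma embed_cyc_image:
  assumes "distinct \<pi>"
  shows "embed_lau (cyc_image (cyc \<pi>)) = perm_series \<pi>"
proof -
  have "embed_lau (cyc_image (cyc \<pi>)) = monom (genfun (\<lambda>m. cyc_weight m (cyc \<pi>))) (length \<pi>)"
    unfolding embed_lau_def cyc_image_def
    by (subst map_poly_monom) (simp_all add: lau_of_eq_genfun[of "interpolate _ _"]
        coeff_at_interpolate degree_cyc_weight)
  then show ?thesis
    using assms by (cases "\<pi> = []")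
      (auto simp: perm_series_def genfun_cyc_weight genfun_cyc_weight_Nil vseries_eq
        Suc_le_eq)
qed

lemma as_target_perm_series:
  assumes "distinct \<pi>"
  shows "as_target (perm_series \<pi>) = cyc_image (cyc \<pi>)"
  unfolding as_target_def embed_cyc_image[OF assms, symmetric]
  by (rule inv_f_f[OF inj_embed_lau])

section \<open>Linear independence of the series v\<close>

lemma to_fract_of_nat: "to_fract (of_nat i :: 'a::idom) = of_nat i"
  by (induction i) simp_all

lemma to_fract_of_int: "to_fract (of_int i :: 'a::idom) = of_int i"
  by (cases i) (simp_all only: of_int_of_nat_eq of_int_minus to_fract_uminus to_fract_of_nat)

text \<open>Only the first two terms of \<open>v\<close> contribute to the power \<open>t^j\<close>. With \<open>d = k - j\<close> their
  contributions are \<open>j y^(d + 1) (1 + y)^(2j - 1)\<close> and \<open>j y^d (1 + y)^(2j - 1)\<close>, which add up to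
  \<open>j y^d (1 + y)^(2j)\<close>.\<close>

lemma vcoeff_leading:
  assumes "1 \<le> j" "j \<le> k" "j + k \<le> n"
  obtains G where "vcoeff n (int j) (int k) = tvar ^ j * fps_to_fls G"
    "fps_nth G 0 = to_fract (of_nat j * (monom 1 (k - j) * [:1, 1:] ^ (2 * j)))"
proof -
  obtain d where k: "k = j + d" using assms by (metis le_add_diff_inverse)
  obtain e where n: "n = 2 * j + d + e" using assms k by (metis le_add_diff_inverse mult_2 add.assoc)
  define c where "c = to_fract [:0::rat, 1:]"
  define Y where "Y = fps_const c"
  define R where "R = inverse (1 - fps_X :: rat poly fract fps) ^ (n + 1)"
  \<comment> \<open>The exponents \<open>d - 1\<close> and \<open>e - 1\<close> truncate only where the coefficient \<open>d\<close> or \<open>e\<close> is 0.\<close>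
  define G where "G = (of_nat j * ((Y + fps_X) ^ (d + 1) * (1 + Y * fps_X) ^ e * (1 + Y) ^ (2 * j - 1))
     + of_nat j * ((Y + fps_X) ^ d * (1 + Y * fps_X) ^ (e + 1) * (1 + Y) ^ (2 * j - 1))
     + of_nat d * (fps_X * (Y + fps_X) ^ (d - 1) * (1 + Y * fps_X) ^ e * (1 + Y) ^ (2 * j + 1))
     + of_nat e * (fps_X * (Y + fps_X) ^ d * (1 + Y * fps_X) ^ (e - 1) * (1 + Y) ^ (2 * j + 1))) * R"
  have tr: "fps_to_fls fps_X = tvar" "fps_to_fls Y = yvar"
    by (simp_all add: tvar_def yvar_def Y_def c_def)
  have "(1 - fps_X) * inverse (1 - fps_X) = (1 :: rat poly fract fps)"
    by (rule inverse_mult_eq_1') simp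
  then have "(1 - tvar) * fps_to_fls (inverse (1 - fps_X)) = 1"
    by (metis fls_times_fps_to_fls fps_one_to_fls fps_to_fls_minus tr(1))
  then have "fps_to_fls (inverse (1 - fps_X)) = inverse (1 - tvar)"
    using basic_series_nonzero(5) by (simp add: inverse_unique)
  then have R: "fps_to_fls R = inverse ((1 - tvar) ^ (n + 1))"
    by (simp only: R_def fps_to_fls_power power_inverse)
  have u1: "ucoeff n (int j - 1) (int k) = tvar ^ j *
      ((yvar + tvar) ^ (d + 1) * (1 + yvar * tvar) ^ e * (1 + yvar) ^ (2 * j - 1)) * fps_to_fls R"
  proof -
    have "int j - 1 + 1 = int j" "int k - (int j - 1) = int (d + 1)"
      "int n - (int j - 1) - int k - 1 = int e" "2 * (int j - 1) + 1 = int (2 * j - 1)"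
      using assms by (simp_all add: k n)
    then show ?thesis by (simp only: ucoeff_def power_int_of_nat R divide_inverse mult_ac)
  qed
  have u2: "ucoeff n (int j - 1) (int k - 1) = tvar ^ j *
      ((yvar + tvar) ^ d * (1 + yvar * tvar) ^ (e + 1) * (1 + yvar) ^ (2 * j - 1)) * fps_to_fls R"
  proof -
    have "int j - 1 + 1 = int j" "int k - 1 - (int j - 1) = int d"
      "int n - (int j - 1) - (int k - 1) - 1 = int (e + 1)" "2 * (int j - 1) + 1 = int (2 * j - 1)"
      using assms by (simp_all add: k n)
    then show ?thesis by (simp only: ucoeff_def power_int_of_nat R divide_inverse mult_ac)
  qed
  have u3: "of_nat d * ucoeff n (int j) (int k - 1) = of_nat d * (tvar ^ j *
      (tvar * (yvar + tvar) ^ (d - 1) * (1 + yvar * tvar) ^ e * (1 + yvar) ^ (2 * j + 1)) * fps_to_fls R)"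
  proof (cases "d = 0")
    case False
    then have "int j + 1 = int (Suc j)" "int k - 1 - int j = int (d - 1)"
      "int n - int j - (int k - 1) - 1 = int e" "2 * int j + 1 = int (2 * j + 1)"
      using assms by (simp_all add: k n)
    then show ?thesis by (simp only: ucoeff_def power_int_of_nat R divide_inverse mult_ac power_Suc)
  qed simp
  have u4: "of_nat e * ucoeff n (int j) (int k) = of_nat e * (tvar ^ j *
      (tvar * (yvar + tvar) ^ d * (1 + yvar * tvar) ^ (e - 1) * (1 + yvar) ^ (2 * j + 1)) * fps_to_fls R)"
  proof (cases "e = 0")
    case False
    then have "int j + 1 = int (Suc j)" "int k - int j = int d"
      "int n - int j - int k - 1 = int (e - 1)" "2 * int j + 1 = int (2 * j + 1)"
      using assms by (simp_all add: k n)
    then show ?thesis by (simp only: ucoeff_def power_int_of_nat R divide_inverse mult_ac power_Suc)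
  qed simp
  have "of_int (int j) = (of_nat j :: lau)" "of_int (int k - int j) = (of_nat d :: lau)"
    "of_int (int n - int j - int k) = (of_nat e :: lau)"
    by (simp_all add: k n)
  then have "vcoeff n (int j) (int k) = of_nat j * ucoeff n (int j - 1) (int k)
      + of_nat j * ucoeff n (int j - 1) (int k - 1) + of_nat d * ucoeff n (int j) (int k - 1)
      + of_nat e * ucoeff n (int j) (int k)"
    by (simp only: vcoeff_def)
  also have "\<dots> = tvar ^ j * fps_to_fls G"
    unfolding u1 u2 u3 u4 G_def fls_times_fps_to_fls fps_to_fls_plus fps_to_fls_power tr
      fps_to_fls_of_nat fps_one_to_fls by (simp only: distrib_left distrib_right mult_ac)
  finally have 1: "vcoeff n (int j) (int k) = tvar ^ j * fps_to_fls G" .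
  have R0: "fps_nth R 0 = 1"
    by (simp add: R_def fps_power_zeroth)
  have "fps_nth G 0 = of_nat j * (c ^ d * (1 + c) ^ (2 * j - 1) * (c + 1))"
    by (simp add: G_def R0 Y_def fps_power_zeroth algebra_simps)
  also have "c ^ d * (1 + c) ^ (2 * j - 1) * (c + 1) = c ^ d * (1 + c) ^ (2 * j)"
    using assms(1) power_Suc[of "1 + c" "2 * j - 1"] by (simp add: algebra_simps)
  also have "c ^ d = to_fract (monom 1 d)"
    by (induction d) (simp_all add: c_def monom_Suc flip: to_fract_mult)
  also have "(1 + c) ^ (2 * j) = to_fract ([:1, 1:] ^ (2 * j))"
  proof -
    have "1 + c = to_fract [:1, 1:]"
      by (simp add: c_def one_pCons flip: to_fract_1 to_fract_add)
    moreover have "to_fract (a ^ i) = to_fract a ^ i" for a :: "rat poly" and i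
      by (induction i) simp_all
    ultimately show ?thesis by simp
  qed
  also have "of_nat j * (to_fract (monom 1 d) * to_fract ([:1, 1:] ^ (2 * j))) =
      to_fract (of_nat j * (monom 1 (k - j) * [:1, 1:] ^ (2 * j)))"
    by (simp add: k to_fract_of_nat)
  finally show ?thesis using 1 that by blast
qed

definition stat_pairs :: "nat \<Rightarrow> (nat \<times> nat) set" where
  "stat_pairs n = {(j, k). 1 \<le> j \<and> j \<le> k \<and> j + k \<le> n}"

lemma finite_stat_pairs: "finite (stat_pairs n)"
  by (rule finite_subset[of _ "{..n} \<times> {..n}"]) (auto simp: stat_pairs_def)

lemma fls_nth_vcoeff:
  assumes "(j, k) \<in> stat_pairs n"
  shows "i < j \<Longrightarrow> fls_nth (vcoeff n (int j) (int k)) (int i) = 0"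
    "fls_nth (vcoeff n (int j) (int k)) (int j) =
       to_fract (of_nat j * (monom 1 (k - j) * [:1, 1:] ^ (2 * j)))"
proof -
  have *: "1 \<le> j" "j \<le> k" "j + k \<le> n"
    using assms by (auto simp: stat_pairs_def)
  obtain G where "vcoeff n (int j) (int k) = tvar ^ j * fps_to_fls G"
    "fps_nth G 0 = to_fract (of_nat j * (monom 1 (k - j) * [:1, 1:] ^ (2 * j)))"
    by (rule vcoeff_leading[OF *])
  then show "i < j \<Longrightarrow> fls_nth (vcoeff n (int j) (int k)) (int i) = 0"
    "fls_nth (vcoeff n (int j) (int k)) (int j) =
       to_fract (of_nat j * (monom 1 (k - j) * [:1, 1:] ^ (2 * j)))"
    by (simp_all add: tvar_def fls_X_power_times_conv_shift)
qed

text \<open>By induction on \<open>j\<close>: at \<open>t^j\<close> the terms with larger first index vanish, and those with first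
  index \<open>j\<close> contribute \<open>y^(k - j)\<close> times a common nonzero factor, so different \<open>k\<close> are separated by
  the power of \<open>y\<close>.\<close>

lemma vcoeff_independent:
  assumes sum: "(\<Sum>(j, k)\<in>stat_pairs n. of_int (c (j, k)) * vcoeff n (int j) (int k)) = 0"
    and mem: "(j, k) \<in> stat_pairs n"
  shows "c (j, k) = 0"
  using mem
proof (induction j arbitrary: k rule: less_induct)
  case (less j)
  let ?f = "\<lambda>k. of_nat j * (monom (1::rat) (k - j) * [:1, 1:] ^ (2 * j))"
  let ?K = "{k. (j, k) \<in> stat_pairs n}"
  have fin: "finite ?K"
    by (rule finite_subset[of _ "{..n}"]) (auto simp: stat_pairs_def)
  have "0 = fls_nth (\<Sum>(j, k)\<in>stat_pairs n. of_int (c (j, k)) * vcoeff n (int j) (int k)) (int j)"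
    unfolding sum by simp
  also have "\<dots> = (\<Sum>p\<in>stat_pairs n. of_int (c p) * fls_nth (vcoeff n (int (fst p)) (int (snd p))) (int j))"
    by (simp add: fls_nth_sum case_prod_beta)
  also have "\<dots> = (\<Sum>p\<in>(\<lambda>k. (j, k)) ` ?K.
      of_int (c p) * fls_nth (vcoeff n (int (fst p)) (int (snd p))) (int j))"
  proof (rule sum.mono_neutral_right[OF finite_stat_pairs])
    show "\<forall>p\<in>stat_pairs n - (\<lambda>k. (j, k)) ` ?K.
        of_int (c p) * fls_nth (vcoeff n (int (fst p)) (int (snd p))) (int j) = 0"
    proof
      fix p assume p: "p \<in> stat_pairs n - (\<lambda>k. (j, k)) ` ?K"
      obtain j' k' where jk: "p = (j', k')" by (cases p)
      with p have "j' \<noteq> j" "(j', k') \<in> stat_pairs n" by auto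
      then show "of_int (c p) * fls_nth (vcoeff n (int (fst p)) (int (snd p))) (int j) = 0"
        using less.IH[of j' k'] fls_nth_vcoeff(1)[of j' k' n j] by (cases "j' < j") (auto simp: jk)
    qed
  qed auto
  also have "\<dots> = (\<Sum>k\<in>?K. of_int (c (j, k)) * to_fract (?f k))"
    by (subst sum.reindex) (auto simp: inj_on_def fls_nth_vcoeff(2) intro!: sum.cong)
  also have "\<dots> = to_fract (\<Sum>k\<in>?K. of_int (c (j, k)) * ?f k)"
    by (simp only: to_fract_sum to_fract_mult to_fract_of_int)
  finally have "to_fract (\<Sum>k\<in>?K. of_int (c (j, k)) * ?f k) = 0"
    by (rule sym)
  then have "(\<Sum>k\<in>?K. of_int (c (j, k)) * ?f k) = 0"
    by (simp only: to_fract_eq_0_iff)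
  moreover have "(\<Sum>k\<in>?K. of_int (c (j, k)) * ?f k) =
      of_nat j * [:1, 1:] ^ (2 * j) * (\<Sum>k\<in>?K. of_int (c (j, k)) * monom 1 (k - j))"
    by (simp only: sum_distrib_left mult_ac)
  moreover have "j \<noteq> 0" using less.prems by (auto simp: stat_pairs_def)
  ultimately have "(\<Sum>k'\<in>?K. of_int (c (j, k')) * monom (1::rat) (k' - j)) = 0"
    by simp
  then have "0 = (\<Sum>k'\<in>?K. coeff (of_int (c (j, k')) * monom (1::rat) (k' - j)) (k - j))"
    unfolding coeff_sum[symmetric] by simp
  also have "\<dots> = (\<Sum>k'\<in>?K. if k' = k then of_int (c (j, k)) else 0)"
    using less.prems by (intro sum.cong) (auto simp: of_int_poly stat_pairs_def)
  also have "\<dots> = of_int (c (j, k))"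
    using fin less.prems by (simp add: sum.delta')
  finally show ?case by simp
qed

section \<open>Shuffle-compatibility\<close>

definition stat_series :: "nat \<Rightarrow> nat \<times> nat \<Rightarrow> lau" where
  "stat_series n p = (if n = 0 then 1 / (1 - tvar) else vcoeff n (int (fst p)) (int (snd p)))"

text \<open>The possible values of the pair of statistics in length \<open>n\<close>; in length 0 and 1 the
  inequalities of \<open>stat_pairs\<close> do not describe them.\<close>

definition stat_range :: "nat \<Rightarrow> (nat \<times> nat) set" where
  "stat_range n = (if n \<le> 1 then {(0, 0)} else stat_pairs n)"

lemma stat_in_range:
  assumes "distinct \<pi>"
  shows "(cpk \<pi>, cdes \<pi>) \<in> stat_range (length \<pi>)"
proof (cases "length \<pi> \<le> 1")
  case True
  then have "\<pi> = [] \<or> (\<exists>x. \<pi> = [x])" by (cases \<pi> rule: remdups_adj.cases) auto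
  then show ?thesis
    by (auto simp: stat_range_def cpk_single cdes_single) (simp_all add: cpk_def cdes_def)
next
  case False
  then show ?thesis
    using cpk_pos[of \<pi>] cpk_le_cdes[of \<pi>] cpk_cdes_le[of \<pi>] assms
    by (simp add: stat_range_def stat_pairs_def)
qed

lemma genfun_eq_stat_series:
  assumes "distinct \<pi>"
  shows "genfun (\<lambda>m. cyc_weight m (cyc \<pi>)) = stat_series (length \<pi>) (cpk \<pi>, cdes \<pi>)"
  using assms by (cases "\<pi> = []")
    (simp_all add: stat_series_def genfun_cyc_weight genfun_cyc_weight_Nil)

lemma vcoeff_1: "vcoeff 1 0 0 = tvar * (1 + yvar) / (1 - tvar) ^ 2"
  by (simp add: vcoeff_def ucoeff_def power2_eq_square)

lemma stat_series_independent:
  assumes sum: "(\<Sum>p\<in>stat_range n. of_int (c p) * stat_series n p) = 0" and p: "p \<in> stat_range n"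
  shows "c p = 0"
proof (cases "n \<le> 1")
  case True
  have "stat_series n (0, 0) \<noteq> 0"
    using True basic_series_nonzero vcoeff_1 by (cases n) (auto simp: stat_series_def)
  then show ?thesis using sum p True by (simp add: stat_range_def)
next
  case False
  then show ?thesis
    using sum p vcoeff_independent[where n = n and c = c and j = "fst p" and k = "snd p"]
    by (simp add: stat_range_def stat_series_def case_prod_beta)
qed

lemma finite_stat_range: "finite (stat_range n)"
  by (simp add: stat_range_def finite_stat_pairs)

lemma count_image_mset_set:
  assumes "finite M"
  shows "count (image_mset f (mset_set M)) p = card {T \<in> M. f T = p}"
proof -
  have "count (image_mset f (mset_set M)) p = (\<Sum>T\<in>{T \<in> M. f T = p}. count (mset_set M) T)"
    using assms by (simp add: count_image_mset vimage_def Int_def conj_commute)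
  also have "\<dots> = (\<Sum>T\<in>{T \<in> M. f T = p}. 1)"
    using assms by (intro sum.cong) simp_all
  finally show ?thesis by simp
qed

text \<open>Grouping the members of \<open>M\<close> by their statistics expresses the sum of their weights as a
  combination of linearly independent series, with the multiplicities as coefficients.\<close>

lemma sum_cyc_weight_determines_stats:
  assumes fin: "finite M" "finite M'"
    and M: "\<And>T. T \<in> M \<union> M' \<Longrightarrow> \<exists>\<tau>. T = cyc \<tau> \<and> distinct \<tau> \<and> length \<tau> = n"
    and eq: "\<And>m. (\<Sum>T\<in>M. cyc_weight m T) = (\<Sum>T\<in>M'. cyc_weight m T)"
  shows "image_mset cpk_cdes (mset_set M) = image_mset cpk_cdes (mset_set M')"
proof -
  let ?cnt = "\<lambda>N p. card {T \<in> N. cpk_cdes T = p}"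
  have T: "genfun (\<lambda>m. cyc_weight m T) = stat_series n (cpk_cdes T)" "cpk_cdes T \<in> stat_range n"
    if "T \<in> M \<union> M'" for T
    using M[OF that] genfun_eq_stat_series stat_in_range by auto
  have expand: "genfun (\<lambda>m. \<Sum>T\<in>N. cyc_weight m T) =
      (\<Sum>p\<in>stat_range n. of_nat (?cnt N p) * stat_series n p)"
    if N: "finite N" "N \<subseteq> M \<union> M'" for N
  proof -
    have "genfun (\<lambda>m. \<Sum>T\<in>N. cyc_weight m T) = (\<Sum>T\<in>N. stat_series n (cpk_cdes T))"
      unfolding genfun_sum using T N by (intro sum.cong) auto
    also have "\<dots> = (\<Sum>p\<in>stat_range n. \<Sum>T\<in>{T \<in> N. cpk_cdes T = p}. stat_series n (cpk_cdes T))"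
      using T N finite_stat_range by (intro sum.group[symmetric]) auto
    finally show ?thesis by simp
  qed
  have "(\<Sum>p\<in>stat_range n. of_nat (?cnt M p) * stat_series n p) =
      (\<Sum>p\<in>stat_range n. of_nat (?cnt M' p) * stat_series n p)"
    using expand[of M] expand[of M'] fin eq by simp
  then have "(\<Sum>p\<in>stat_range n. of_int (int (?cnt M p) - int (?cnt M' p)) * stat_series n p) = 0"
    by (simp add: left_diff_distrib sum_subtractf)
  then have cnt: "?cnt M p = ?cnt M' p" if "p \<in> stat_range n" for p
    using stat_series_independent[where n = n and p = p and c = "\<lambda>p. int (?cnt M p) - int (?cnt M' p)"] that
    by simp
  show ?thesis
  proof (rule multiset_eqI)
    fix p
    show "count (image_mset cpk_cdes (mset_set M)) p = count (image_mset cpk_cdes (mset_set M')) p"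
    proof (cases "p \<in> stat_range n")
      case True
      then show ?thesis using fin cnt by (simp add: count_image_mset_set)
    next
      case False
      then have "{T \<in> M. cpk_cdes T = p} = {}" "{T \<in> M'. cpk_cdes T = p} = {}"
        using T(2) by blast+
      then show ?thesis using fin by (simp only: count_image_mset_set)
    qed
  qed
qed

lemma cpk_cdes_order_invariant:
  assumes len: "length v = length w"
    and less: "\<And>i j. i < length w \<Longrightarrow> j < length w \<Longrightarrow> v ! i < v ! j \<longleftrightarrow> w ! i < w ! j"
  shows "cpk v = cpk w" "cdes v = cdes w"
proof -
  have m: "(i + 1) mod length w < length w" "(i + length w - 1) mod length w < length w"
    if "i < length w" for i
    using that by (intro mod_less_divisor; linarith)+
  have d: "desc_at v i = desc_at w i" and p: "peak_at v i = peak_at w i" if "i < length w" for i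
    using that m[OF that] less unfolding peak_at_def desc_at_def len by blast+
  show "cpk v = cpk w" "cdes v = cdes w"
    unfolding cpk_eq_sum cdes_eq_sum len by (auto intro!: sum.cong simp: d p simp del: sum_of_bool_eq)
qed

text \<open>Standardization does not change which of two letters is smaller, and the statistics depend
  on nothing else.\<close>

lemma cyclic_statistic_cpk_cdes: "cyclic_statistic cpk_cdes"
  unfolding cyclic_statistic_def
proof (intro allI impI)
  fix \<pi> \<sigma> :: "nat list" assume *: "is_perm \<pi> \<and> is_perm \<sigma> \<and> std \<pi> = std \<sigma>"
  then have len: "length \<pi> = length \<sigma>" by (metis length_map std_def)
  have mono: "std \<rho> ! i < std \<rho> ! j \<longleftrightarrow> \<rho> ! i < \<rho> ! j"
    if "i < length \<rho>" "j < length \<rho>" for \<rho> i j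
  proof
    assume "\<rho> ! i < \<rho> ! j"
    then have "{b \<in> set \<rho>. b \<le> \<rho> ! i} \<subseteq> {b \<in> set \<rho>. b \<le> \<rho> ! j}"
      "\<rho> ! j \<in> {b \<in> set \<rho>. b \<le> \<rho> ! j}" "\<rho> ! j \<notin> {b \<in> set \<rho>. b \<le> \<rho> ! i}"
      using that by auto
    then have "{b \<in> set \<rho>. b \<le> \<rho> ! i} \<subset> {b \<in> set \<rho>. b \<le> \<rho> ! j}"
      by blast
    then show "std \<rho> ! i < std \<rho> ! j"
      using that by (simp add: std_def psubset_card_mono)
  next
    assume "std \<rho> ! i < std \<rho> ! j"
    moreover have "card {b \<in> set \<rho>. b \<le> \<rho> ! j} \<le> card {b \<in> set \<rho>. b \<le> \<rho> ! i}" if "\<rho> ! j \<le> \<rho> ! i"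
      using that by (intro card_mono) auto
    ultimately show "\<rho> ! i < \<rho> ! j"
      using that by (simp add: std_def) (meson leI le_less_trans less_irrefl)
  qed
  have "\<pi> ! i < \<pi> ! j \<longleftrightarrow> \<sigma> ! i < \<sigma> ! j" if "i < length \<sigma>" "j < length \<sigma>" for i j
    using that mono[of i \<pi> j] mono[of i \<sigma> j] * len by simp
  from cpk_cdes_order_invariant[OF len this] show "cpk_cdes (cyc \<pi>) = cpk_cdes (cyc \<sigma>)" by simp
qed

lemma cSh_member:
  assumes "disjoint_perms \<pi> \<sigma>" "T \<in> cSh (cyc \<pi>) (cyc \<sigma>)"
  shows "\<exists>\<tau>. T = cyc \<tau> \<and> is_perm \<tau> \<and> length \<tau> = length \<pi> + length \<sigma>"
  using assms by (auto simp: cSh_def Sh_def cyc_def)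

lemma cyclic_shuffle_compatible_cpk_cdes: "cyclic_shuffle_compatible cpk_cdes"
  unfolding cyclic_shuffle_compatible_def
proof (intro conjI allI impI cyclic_statistic_cpk_cdes)
  fix \<pi> \<sigma> \<pi>' \<sigma>'
  assume *: "disjoint_perms \<pi> \<sigma> \<and> disjoint_perms \<pi>' \<sigma>' \<and> cpk_cdes (cyc \<pi>) = cpk_cdes (cyc \<pi>') \<and>
    cpk_cdes (cyc \<sigma>) = cpk_cdes (cyc \<sigma>') \<and> length \<pi> = length \<pi>' \<and> length \<sigma> = length \<sigma>'"
  have "cyc_weight m (cyc \<rho>) = cyc_weight m (cyc \<rho>')"
    if "is_perm \<rho>" "is_perm \<rho>'" "cpk_cdes (cyc \<rho>) = cpk_cdes (cyc \<rho>')" "length \<rho> = length \<rho>'" for m \<rho> \<rho>'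
  proof -
    have "genfun (\<lambda>m. cyc_weight m (cyc \<rho>)) = genfun (\<lambda>m. cyc_weight m (cyc \<rho>'))"
      using that by (simp add: genfun_eq_stat_series is_perm_def)
    then show ?thesis unfolding genfun_inject by (rule fun_cong)
  qed
  then have eq: "cyc_weight m (cyc \<pi>) = cyc_weight m (cyc \<pi>')" "cyc_weight m (cyc \<sigma>) = cyc_weight m (cyc \<sigma>')" for m
    using * by (simp_all add: disjoint_perms_def)
  show "image_mset cpk_cdes (mset_set (cSh (cyc \<pi>) (cyc \<sigma>))) =
        image_mset cpk_cdes (mset_set (cSh (cyc \<pi>') (cyc \<sigma>')))"
  proof (rule sum_cyc_weight_determines_stats)
    show "finite (cSh (cyc \<pi>) (cyc \<sigma>))" "finite (cSh (cyc \<pi>') (cyc \<sigma>'))"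
      using * finite_cSh by auto
    show "\<exists>\<tau>. T = cyc \<tau> \<and> distinct \<tau> \<and> length \<tau> = length \<pi> + length \<sigma>"
      if "T \<in> cSh (cyc \<pi>) (cyc \<sigma>) \<union> cSh (cyc \<pi>') (cyc \<sigma>')" for T
      using that * cSh_member[of \<pi> \<sigma> T] cSh_member[of \<pi>' \<sigma>' T] by (auto simp: is_perm_def)
    show "(\<Sum>T\<in>cSh (cyc \<pi>) (cyc \<sigma>). cyc_weight m T) = (\<Sum>T\<in>cSh (cyc \<pi>') (cyc \<sigma>'). cyc_weight m T)" for m
      using * by (simp add: cyc_weight_mult eq)
  qed
qed

section \<open>Permutations with prescribed statistics\<close>

lemma des_append_greater:
  "w \<noteq> [] \<Longrightarrow> last w < x \<Longrightarrow> des (w @ [x]) = des w"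
proof (induction w rule: induct_list012)
  case (3 a b w)
  then show ?case by (simp add: des_Cons2)
qed (simp_all add: des_Cons2 des_single)

lemma pk_append_greater:
  "w \<noteq> [] \<Longrightarrow> last w < x \<Longrightarrow> pk (w @ [x]) = pk w"
proof (induction w rule: induct_list012)
  case (3 a b w)
  then show ?case by (cases w) (auto simp: pk_Cons3 pk_double)
qed (simp_all add: pk_double pk_single)

lemma pk_Cons_greater:
  assumes "w \<noteq> []" "x > hd w"
  shows "pk (x # w) = pk w"
  using assms by (cases w rule: remdups_adj.cases) (auto simp: pk_Cons3 pk_double pk_single)

text \<open>A new maximum in front adds a descent, a new maximum at the end adds an ascent, and two new
  maxima in front, in increasing order, add a peak together with its descent. The first is used
  while \<open>p < d\<close>, the second when \<open>p = d\<close> and \<open>p + d + 1 < l\<close>, and the third when \<open>p = d > 0\<close> and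
  \<open>l = p + d + 1\<close>.\<close>

lemma ex_linear_pk_des:
  assumes "p \<le> d" "p + d < l"
  shows "\<exists>w. distinct w \<and> set w = {1..l} \<and> pk w = p \<and> des w = d"
  using assms
proof (induction l arbitrary: p d rule: less_induct)
  case (less l)
  consider "p < d" | "p = d" "p + d + 1 < l" | "p = d" "l = p + d + 1" using less.prems by linarith
  then show ?case
  proof cases
    case 1
    then have "p \<le> d - 1" "p + (d - 1) < l - 1" "l - 1 < l" using less.prems by linarith+
    then obtain w where w: "distinct w" "set w = {1..l - 1}" "pk w = p" "des w = d - 1"
      using less.IH[of "l - 1" p "d - 1"] by blast
    have "w \<noteq> []" using w(2) 1 less.prems by auto
    then have "hd w < l" using w(2) hd_in_set[of w] by auto
    then have "pk (l # w) = p" "des (l # w) = d"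
      using w \<open>w \<noteq> []\<close> 1 pk_Cons_greater[of w l] by (auto simp: neq_Nil_conv des_Cons2)
    moreover have "distinct (l # w)" "set (l # w) = {1..l}" using w 1 less.prems by auto
    ultimately show ?thesis by blast
  next
    case 2
    then have "p \<le> d" "p + d < l - 1" "l - 1 < l" by linarith+
    then obtain w where w: "distinct w" "set w = {1..l - 1}" "pk w = p" "des w = d"
      using less.IH[of "l - 1" p d] by blast
    have "w \<noteq> []" using w(2) 2 by auto
    then have "last w < l" using w(2) last_in_set[of w] by auto
    then have "pk (w @ [l]) = p" "des (w @ [l]) = d"
      using w \<open>w \<noteq> []\<close> by (auto simp: pk_append_greater des_append_greater)
    moreover have "distinct (w @ [l])" "set (w @ [l]) = {1..l}" using w 2 less.prems by auto
    ultimately show ?thesis by blast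
  next
    case 3
    show ?thesis
    proof (cases "p = 0")
      case True
      with 3 show ?thesis by (intro exI[of _ "[1]"]) (auto simp: pk_single des_single)
    next
      case False
      then have "l - 2 < l" "p - 1 \<le> p - 1" "(p - 1) + (p - 1) < l - 2" using 3 by linarith+
      then obtain w where w: "distinct w" "set w = {1..l - 2}" "pk w = p - 1" "des w = p - 1"
        using less.IH[of "l - 2" "p - 1" "p - 1"] by blast
      have ne: "w \<noteq> []" using w(2) 3 False by auto
      then have hd: "hd w < l" using w(2) hd_in_set[of w] 3 by auto
      have "pk ((l - 1) # l # w) = p"
        using w(3) ne hd False 3 pk_Cons_greater[OF ne hd] by (auto simp: neq_Nil_conv pk_Cons3)
      moreover have "des ((l - 1) # l # w) = d"
        using w(4) ne hd False 3 by (auto simp: neq_Nil_conv des_Cons2)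
      moreover have "distinct ((l - 1) # l # w)" "set ((l - 1) # l # w) = {1..l}"
        using w(1,2) 3 False by auto
      ultimately show ?thesis by blast
    qed
  qed
qed

text \<open>Placed in front of a linear word, a maximum becomes one more cyclic peak and one more cyclic
  descent, and the step from the last letter back to it is an ascent.\<close>

lemma ex_perm_with_stats:
  assumes "(j, k) \<in> stat_range n"
  shows "\<exists>\<pi>. is_perm \<pi> \<and> length \<pi> = n \<and> cpk \<pi> = j \<and> cdes \<pi> = k"
proof (cases "n \<le> 1")
  case True
  define \<pi> where "\<pi> = replicate n (1::nat)"
  have "is_perm \<pi>" "length \<pi> = n"
    using True by (cases n; simp add: \<pi>_def is_perm_def)+
  moreover have "cpk \<pi> = 0" "cdes \<pi> = 0"
    using stat_in_range[of \<pi>] calculation True by (simp_all add: stat_range_def is_perm_def)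
  ultimately show ?thesis using assms True by (auto simp: stat_range_def)
next
  case False
  with assms have jk: "1 \<le> j" "j \<le> k" "j + k \<le> n" by (auto simp: stat_range_def stat_pairs_def)
  then have "j - 1 \<le> k - 1" "(j - 1) + (k - 1) < n - 1" by linarith+
  then obtain w where w: "distinct w" "set w = {1..n - 1}" "pk w = j - 1" "des w = k - 1"
    using ex_linear_pk_des by blast
  have len: "length w = n - 1" using w(1,2) distinct_card by fastforce
  have ne: "w \<noteq> []" using len False by auto
  let ?\<pi> = "n # w"
  have less: "hd w < n" "last w < n" using w(2) ne hd_in_set[of w] last_in_set[of w] False by auto
  have L: "length ?\<pi> = n" "length ?\<pi> \<ge> 2" using len False by auto
  have last: "?\<pi> ! (n - 1) = last w" using ne len False by (simp add: last_conv_nth)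
  have nd: "\<not> desc_at ?\<pi> (n - 1)"
    using less(2) False unfolding desc_at_def L last by simp
  have pk0: "peak_at ?\<pi> 0"
    using less ne False last unfolding peak_at_def desc_at_def L by (simp add: hd_conv_nth)
  have "cdes ?\<pi> = des ?\<pi>"
    using cdes_eq_des[OF L(2)] nd unfolding L by simp
  also have "\<dots> = k"
    using w(4) ne less jk by (auto simp: neq_Nil_conv des_Cons2)
  finally have "cdes ?\<pi> = k" .
  have "\<not> peak_at ?\<pi> (n - 1)" using nd by (simp add: peak_at_def)
  then have "cpk ?\<pi> = pk ?\<pi> + 1"
    using cpk_eq_pk[OF L(2)] pk0 unfolding L by simp
  also have "\<dots> = j" using w(3) pk_Cons_greater[OF ne less(1)] jk by simp
  finally have "cpk ?\<pi> = j" .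
  moreover have "is_perm ?\<pi>" using w False by (auto simp: is_perm_def)
  ultimately show ?thesis using \<open>cdes ?\<pi> = k\<close> L by blast
qed

section \<open>The homomorphism\<close>

lemma perm_series_eqI:
  assumes "cpk_cdes (cyc \<pi>) = cpk_cdes (cyc \<sigma>)" "length \<pi> = length \<sigma>"
  shows "perm_series \<pi> = perm_series \<sigma>"
  using assms by (simp add: perm_series_def)

lemma cyc_image_eqI:
  assumes "is_perm \<pi>" "is_perm \<sigma>"
    and "cyc_class cpk_cdes (cyc \<pi>) = cyc_class cpk_cdes (cyc \<sigma>)"
  shows "cyc_image (cyc \<pi>) = cyc_image (cyc \<sigma>)"
proof -
  have "perm_series \<pi> = perm_series \<sigma>"
    using assms by (intro perm_series_eqI) (simp_all add: cyc_class_eq_iff)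
  then show ?thesis
    using assms as_target_perm_series by (metis is_perm_def)
qed

text \<open>The constraints on the indices of the generators are exactly those satisfied by the
  statistics of permutations of length at least 2; the two separate generators belong to the
  lengths 0 and 1.\<close>

lemma gens_eq: "gens = perm_series ` {\<pi>. is_perm \<pi>}"
proof (intro equalityI subsetI)
  fix r assume "r \<in> gens"
  then consider "r = monom (1 / (1 - tvar)) 0" | "r = monom (tvar * (1 + yvar) / (1 - tvar) ^ 2) 1"
    | n j k where "r = vseries n (int j) (int k)" "n \<ge> 2" "1 \<le> j" "j \<le> n div 2" "j \<le> k" "k \<le> n - j"
    unfolding gens_def by blast
  then show "r \<in> perm_series ` {\<pi>. is_perm \<pi>}"
  proof cases
    case 1
    then have "r = perm_series []" by (simp add: perm_series_def)
    moreover have "is_perm []" by (simp add: is_perm_def)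
    ultimately show ?thesis by blast
  next
    case 2
    then have "r = perm_series [1]"
      by (simp add: perm_series_def vseries_eq cpk_single cdes_single vcoeff_1[unfolded One_nat_def])
    moreover have "is_perm [1]" by (simp add: is_perm_def)
    ultimately show ?thesis by blast
  next
    case 3
    then have "(j, k) \<in> stat_range n" by (auto simp: stat_range_def stat_pairs_def)
    then obtain \<pi> where "is_perm \<pi>" "length \<pi> = n" "cpk \<pi> = j" "cdes \<pi> = k"
      using ex_perm_with_stats by blast
    moreover from this 3 have "r = perm_series \<pi>" by (simp add: perm_series_def)
    ultimately show ?thesis by blast
  qed
next
  fix r assume "r \<in> perm_series ` {\<pi>. is_perm \<pi>}"
  then obtain \<pi> where \<pi>: "is_perm \<pi>" "r = perm_series \<pi>" by blast
  consider "\<pi> = []" | x where "\<pi> = [x]" | "length \<pi> \<ge> 2"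
    by (cases \<pi> rule: remdups_adj.cases) auto
  then show "r \<in> gens"
  proof cases
    case 1
    then show ?thesis by (simp add: \<pi>(2) perm_series_def gens_def)
  next
    case 2
    then show ?thesis
      by (simp add: \<pi>(2) perm_series_def gens_def vseries_eq cpk_single cdes_single vcoeff_1[unfolded One_nat_def])
  next
    case 3
    then have "1 \<le> cpk \<pi>" "cpk \<pi> \<le> cdes \<pi>" "cpk \<pi> + cdes \<pi> \<le> length \<pi>"
      using \<pi>(1) cpk_pos[of \<pi>] cpk_le_cdes cpk_cdes_le by (auto simp: is_perm_def)
    then have "cpk \<pi> \<le> length \<pi> div 2" "cdes \<pi> \<le> length \<pi> - cpk \<pi>" by linarith+
    moreover have "r = vseries (length \<pi>) (int (cpk \<pi>)) (int (cdes \<pi>))"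
      using 3 by (simp add: \<pi>(2) perm_series_def)
    ultimately show ?thesis
      using 3 \<open>1 \<le> cpk \<pi>\<close> \<open>cpk \<pi> \<le> cdes \<pi>\<close> unfolding gens_def by blast
  qed
qed

lemma gens_subset_range: "gens \<subseteq> range embed_lau"
  unfolding gens_eq using embed_cyc_image by (auto simp: is_perm_def) (metis rangeI)

lemma as_target_gens: "as_target ` gens = (\<lambda>\<pi>. cyc_image (cyc \<pi>)) ` {\<pi>. is_perm \<pi>}"
  unfolding gens_eq image_image using as_target_perm_series by (intro image_cong) (auto simp: is_perm_def)

abbreviation target_span :: "target set" where
  "target_span \<equiv> target.span (as_target ` gens)"

lemma cyc_image_in_span: "is_perm \<pi> \<Longrightarrow> cyc_image (cyc \<pi>) \<in> target_span"
  by (rule target.span_base) (auto simp: as_target_gens)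

text \<open>Adding a large constant to all letters of \<open>\<sigma>\<close> changes no comparison.\<close>

lemma disjoint_representatives:
  assumes "is_perm \<pi>" "is_perm \<sigma>"
  obtains \<sigma>' where "disjoint_perms \<pi> \<sigma>'"
    "cyc_class cpk_cdes (cyc \<sigma>') = cyc_class cpk_cdes (cyc \<sigma>)"
proof
  \<comment> \<open>Inserting 0 makes the maximum meaningful for the empty \<open>\<pi>\<close> as well.\<close>
  let ?N = "Suc (Max (insert 0 (set \<pi>)))"
  let ?\<sigma> = "map ((+) ?N) \<sigma>"
  have "x < ?N" if "x \<in> set \<pi>" for x
    unfolding less_Suc_eq_le using that by (intro Max_ge) auto
  then have "set \<pi> \<inter> set ?\<sigma> = {}" by fastforce
  then show d: "disjoint_perms \<pi> ?\<sigma>"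
    using assms by (auto simp: disjoint_perms_def is_perm_def distinct_map inj_on_def)
  have "cpk ?\<sigma> = cpk \<sigma>" "cdes ?\<sigma> = cdes \<sigma>"
    by (rule cpk_cdes_order_invariant; simp)+
  then show "cyc_class cpk_cdes (cyc ?\<sigma>) = cyc_class cpk_cdes (cyc \<sigma>)"
    using assms d by (simp add: cyc_class_eq_iff disjoint_perms_def)
qed

lemma cyc_image_prod_in_span:
  assumes "is_perm \<pi>" "is_perm \<sigma>"
  shows "cyc_image (cyc \<pi>) * cyc_image (cyc \<sigma>) \<in> target_span"
proof -
  obtain \<sigma>' where \<sigma>': "disjoint_perms \<pi> \<sigma>'"
    "cyc_class cpk_cdes (cyc \<sigma>') = cyc_class cpk_cdes (cyc \<sigma>)"
    using disjoint_representatives[OF assms] .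
  then have "cyc_image (cyc \<sigma>) = cyc_image (cyc \<sigma>')"
    using assms by (intro cyc_image_eqI) (auto simp: disjoint_perms_def)
  moreover have "cyc_image T \<in> target_span" if "T \<in> cSh (cyc \<pi>) (cyc \<sigma>')" for T
    using cSh_member[OF \<sigma>'(1) that] cyc_image_in_span by blast
  ultimately show ?thesis
    by (simp add: cyc_image_mult[OF \<sigma>'(1)] target.span_sum)
qed

definition hconst :: "rat \<Rightarrow> hps" where
  "hconst q = hps_of_fps (Abs_fps (\<lambda>_. q))"

lemma tscale_eq_smult: "tscale q P = smult [:hconst q:] P"
proof (intro poly_eqI)
  fix n i
  have "hscale q a = hconst q * a" for a
    unfolding hconst_def hscale_def times_hps_def
    by (simp add: hps_of_fps_inverse fps_eq_iff hps_of_fps_inject)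
  then show "coeff (coeff (tscale q P) n) i = coeff (coeff (smult [:hconst q:] P) n) i"
    by (simp add: coeff_tscale)
qed

lemma tscale_mult: "tscale q P * Q = tscale q (P * Q)" "P * tscale q Q = tscale q (P * Q)"
  by (simp_all add: tscale_eq_smult)

lemma cyc_image_Nil: "cyc_image (cyc []) = 1"
proof -
  have "interpolate 0 (\<lambda>m. cyc_weight m (cyc [])) = 1"
  proof (rule coeff_at_eqI)
    fix m
    have "coeff_at m 1 = 1"
      by (rule poly_eqI) (auto simp: coeff_coeff_at one_hps.rep_eq zero_hps.rep_eq coeff_1)
    then show "coeff_at m (interpolate 0 (\<lambda>m. cyc_weight m (cyc []))) = coeff_at m 1"
      by (subst coeff_at_interpolate) (simp_all add: cyc_weight_def cyc_Nil)
  qed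
  then show ?thesis by (simp add: cyc_image_def monom_0)
qed

lemma is_subalgebra_target_span: "is_subalgebra target_span"
  unfolding is_subalgebra_def
proof (intro conjI ballI)
  show "target.subspace target_span" by (rule target.subspace_span)
  show "1 \<in> target_span"
    using cyc_image_in_span[of "[]"] by (simp add: cyc_image_Nil is_perm_def)
  fix p q assume p: "p \<in> target_span" and q: "q \<in> target_span"
  have 1: "a * q \<in> target_span" if a: "a \<in> as_target ` gens" for a
    using q
  proof (induction rule: target.span_induct)
    case base
    show ?case
      by (rule target.subspaceI)
         (auto simp: target.span_zero distrib_left target.span_add tscale_mult target.span_scale)
  next
    case (step b)
    with a show ?case
      using cyc_image_prod_in_span by (auto simp: as_target_gens)
  qed
  show "p * q \<in> target_span"
    using p
  proof (induction rule: target.span_induct)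
    case base
    show ?case
      by (rule target.subspaceI)
         (auto simp: target.span_zero distrib_right target.span_add tscale_mult target.span_scale)
  qed (rule 1)
qed

text \<open>The representative is irrelevant by \<open>cyc_image_eqI\<close>.\<close>

definition class_image :: "cperm set \<Rightarrow> target" where
  "class_image A = cyc_image (SOME C. C \<in> A)"

lemma class_image_eq:
  assumes "is_perm \<pi>"
  shows "class_image (cyc_class cpk_cdes (cyc \<pi>)) = cyc_image (cyc \<pi>)"
proof -
  have "cyc \<pi> \<in> cyc_class cpk_cdes (cyc \<pi>)"
    using assms by (auto simp: cyc_class_def)
  then have "(SOME C. C \<in> cyc_class cpk_cdes (cyc \<pi>)) \<in> cyc_class cpk_cdes (cyc \<pi>)"
    by (rule someI)
  then obtain \<sigma> where "(SOME C. C \<in> cyc_class cpk_cdes (cyc \<pi>)) = cyc \<sigma>" "is_perm \<sigma>"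
    "cpk_cdes (cyc \<sigma>) = cpk_cdes (cyc \<pi>)" "clen (cyc \<sigma>) = clen (cyc \<pi>)"
    unfolding cyc_class_def by blast
  then show ?thesis
    unfolding class_image_def
    using cyc_image_eqI[of \<sigma> \<pi>] assms by (simp add: cyc_class_eq_iff)
qed

definition hom_map :: "cvec \<Rightarrow> target" where
  "hom_map f = (\<Sum>A\<in>Poly_Mapping.keys f. tscale (Poly_Mapping.lookup f A) (class_image A))"

lemma hom_map_superset:
  assumes "finite K" "Poly_Mapping.keys f \<subseteq> K"
  shows "hom_map f = (\<Sum>A\<in>K. tscale (Poly_Mapping.lookup f A) (class_image A))"
  unfolding hom_map_def using assms
  by (intro sum.mono_neutral_left) (auto simp: in_keys_iff)

lemma hom_map_add: "hom_map (f + g) = hom_map f + hom_map g"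
proof -
  let ?K = "Poly_Mapping.keys f \<union> Poly_Mapping.keys g"
  have fin: "finite ?K" by simp
  have "Poly_Mapping.keys (f + g) \<subseteq> ?K" by (rule keys_add)
  then show ?thesis
    using hom_map_superset[OF fin, of f] hom_map_superset[OF fin, of g] hom_map_superset[OF fin, of "f + g"]
    by (simp add: lookup_add target.scale_left_distrib sum.distrib)
qed

lemma hom_map_scale: "hom_map (cscale q f) = tscale q (hom_map f)"
proof -
  have "Poly_Mapping.keys (cscale q f) \<subseteq> Poly_Mapping.keys f"
    by (auto simp: in_keys_iff lookup_cscale)
  then show ?thesis
    using hom_map_superset[of "Poly_Mapping.keys f" "cscale q f"]
    by (simp add: lookup_cscale hom_map_def target.scale_sum_right)
qed

lemma linear_hom_map: "Vector_Spaces.linear cscale tscale hom_map"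
  by (intro Vector_Spaces.linear.intro module_hom.intro module_hom_axioms.intro
      cvec.vector_space_axioms target.vector_space_axioms cvec.module_axioms target.module_axioms
      hom_map_add hom_map_scale)

lemma hom_map_sum: "hom_map (\<Sum>i\<in>I. f i) = (\<Sum>i\<in>I. hom_map (f i))"
proof (induction I rule: infinite_finite_induct)
  case (insert x F)
  then show ?case by (simp add: hom_map_add)
qed (simp_all add: hom_map_def)

lemma hom_map_basis_vec:
  assumes "is_perm \<pi>"
  shows "hom_map (basis_vec cpk_cdes (cyc \<pi>)) = cyc_image (cyc \<pi>)"
  by (simp add: hom_map_def basis_vec_def class_image_eq[OF assms])

lemma hom_map_class_times:
  assumes "is_perm \<pi>" "is_perm \<sigma>"
    and A: "A = cyc_class cpk_cdes (cyc \<pi>)" and B: "B = cyc_class cpk_cdes (cyc \<sigma>)"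
  shows "hom_map (class_times cpk_cdes A B) = class_image A * class_image B"
proof -
  obtain \<sigma>' where \<sigma>': "disjoint_perms \<pi> \<sigma>'"
    "cyc_class cpk_cdes (cyc \<sigma>') = cyc_class cpk_cdes (cyc \<sigma>)"
    using disjoint_representatives[OF assms(1,2)] .
  have perm: "is_perm \<sigma>'" using \<sigma>'(1) by (simp add: disjoint_perms_def)
  have "hom_map (class_times cpk_cdes A B) =
      hom_map (\<Sum>T\<in>cSh (cyc \<pi>) (cyc \<sigma>'). basis_vec cpk_cdes T)"
    unfolding A B \<sigma>'(2)[symmetric]
    by (simp only: class_times_eq[OF cyclic_shuffle_compatible_cpk_cdes \<sigma>'(1)])
  also have "\<dots> = (\<Sum>T\<in>cSh (cyc \<pi>) (cyc \<sigma>'). cyc_image T)"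
    unfolding hom_map_sum
    using cSh_member[OF \<sigma>'(1)] hom_map_basis_vec by (intro sum.cong refl) metis
  also have "\<dots> = class_image A * class_image B"
    unfolding A B \<sigma>'(2)[symmetric] class_image_eq[OF assms(1)] class_image_eq[OF perm]
    by (rule cyc_image_mult[OF \<sigma>'(1), symmetric])
  finally show ?thesis .
qed

lemma hom_map_ctimes:
  assumes "f \<in> cyc_alg cpk_cdes" "g \<in> cyc_alg cpk_cdes"
  shows "hom_map (ctimes cpk_cdes f g) = hom_map f * hom_map g"
proof -
  have "hom_map (ctimes cpk_cdes f g) =
      (\<Sum>A\<in>Poly_Mapping.keys f. \<Sum>B\<in>Poly_Mapping.keys g.
        tscale (Poly_Mapping.lookup f A * Poly_Mapping.lookup g B) (class_image A * class_image B))"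
    unfolding ctimes_def hom_map_sum hom_map_scale
  proof (intro sum.cong refl arg_cong[where f = "tscale _"])
    fix A B assume AB: "A \<in> Poly_Mapping.keys f" "B \<in> Poly_Mapping.keys g"
    obtain \<pi> where "is_perm \<pi>" "A = cyc_class cpk_cdes (cyc \<pi>)"
      using AB(1) assms(1) unfolding cyc_alg_def by blast
    moreover obtain \<sigma> where "is_perm \<sigma>" "B = cyc_class cpk_cdes (cyc \<sigma>)"
      using AB(2) assms(2) unfolding cyc_alg_def by blast
    ultimately show "hom_map (class_times cpk_cdes A B) = class_image A * class_image B"
      by (intro hom_map_class_times)
  qed
  also have "\<dots> = hom_map f * hom_map g"
    by (simp add: hom_map_def sum_product tscale_mult mult.commute)
  finally show ?thesis .
qed

lemma is_cyc_alg_hom_hom_map: "is_cyc_alg_hom cpk_cdes hom_map target_span"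
  unfolding is_cyc_alg_hom_def
proof (intro conjI ballI linear_hom_map hom_map_ctimes)
  show "hom_map ` cyc_alg cpk_cdes \<subseteq> target_span"
  proof (intro image_subsetI)
    fix f assume f: "f \<in> cyc_alg cpk_cdes"
    have "class_image A \<in> target_span" if A: "A \<in> Poly_Mapping.keys f" for A
    proof -
      obtain \<pi> where "is_perm \<pi>" "A = cyc_class cpk_cdes (cyc \<pi>)"
        using A f unfolding cyc_alg_def by blast
      then show ?thesis by (simp add: class_image_eq cyc_image_in_span)
    qed
    then show "hom_map f \<in> target_span"
      unfolding hom_map_def by (intro target.span_sum target.span_scale)
  qed
  show "hom_map (cone cpk_cdes) = 1"
    using hom_map_basis_vec[of "[]"] by (simp add: cone_def is_perm_def cyc_image_Nil)
qed

section \<open>Dimensions\<close>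

lemma single_1_inject:
  assumes "Poly_Mapping.single A (1::rat) = Poly_Mapping.single B 1"
  shows "A = B"
  using assms by (metis lookup_single_eq lookup_single_not_eq zero_neq_one)

lemma independent_singles: "cvec.independent ((\<lambda>A. Poly_Mapping.single A 1) ` S)"
  unfolding cvec.independent_explicit_module
proof (intro allI impI)
  fix t u v
  assume t: "finite t" "t \<subseteq> (\<lambda>A. Poly_Mapping.single A 1) ` S" "(\<Sum>v\<in>t. cscale (u v) v) = 0" "v \<in> t"
  then obtain A where A: "v = Poly_Mapping.single A 1" by blast
  have "0 = Poly_Mapping.lookup (\<Sum>v\<in>t. cscale (u v) v) A"
    by (simp add: t(3))
  also have "\<dots> = (\<Sum>v'\<in>t. u v' * Poly_Mapping.lookup v' A)"
    by (simp add: lookup_sum lookup_cscale)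
  also have "\<dots> = (\<Sum>v'\<in>t. if v' = v then u v else 0)"
  proof (intro sum.cong refl)
    fix v' assume "v' \<in> t"
    then obtain A' where "v' = Poly_Mapping.single A' 1" using t(2) by blast
    then show "u v' * Poly_Mapping.lookup v' A = (if v' = v then u v else 0)"
      by (cases "A' = A") (auto simp: A lookup_single when_def dest: single_1_inject)
  qed
  also have "\<dots> = u v" using t by simp
  finally show "u v = 0" by simp
qed

text \<open>For each \<open>j\<close> with \<open>1 \<le> j \<le> n div 2\<close> there are \<open>n - 2j + 1\<close> values of \<open>k\<close>.\<close>

lemma card_stat_pairs: "card (stat_pairs n) = (n div 2) * (n - n div 2)"
proof -
  have "stat_pairs n = (SIGMA j:{1..n div 2}. {j..n - j})"
    by (auto simp: stat_pairs_def)
  then have "card (stat_pairs n) = (\<Sum>j=1..n div 2. Suc (n - j) - j)"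
    by simp
  also have "(\<Sum>j=1..h. Suc (n - j) - j) = h * (n - h)" if "2 * h \<le> n" for h
    using that
  proof (induction h)
    case (Suc h)
    then obtain e where "n = 2 * Suc h + e" using le_Suc_ex by blast
    with Suc show ?case by (simp add: algebra_simps)
  qed simp
  finally show ?thesis by simp
qed

lemma dim_cyc_alg_comp:
  assumes "n \<ge> 2"
  shows "cvec.dim (cyc_alg_comp cpk_cdes n) = card (stat_pairs n)"
proof -
  have range: "stat_range n = stat_pairs n" using assms by (simp add: stat_range_def)
  have "\<forall>p\<in>stat_pairs n. \<exists>\<pi>. is_perm \<pi> \<and> length \<pi> = n \<and> (cpk \<pi>, cdes \<pi>) = p"
    using ex_perm_with_stats[of _ _ n] range by auto
  then obtain r where r: "\<And>p. p \<in> stat_pairs n \<Longrightarrow>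
      is_perm (r p) \<and> length (r p) = n \<and> (cpk (r p), cdes (r p)) = p"
    by metis
  let ?c = "\<lambda>p. cyc_class cpk_cdes (cyc (r p))"
  have inj: "inj_on ?c (stat_pairs n)"
  proof (rule inj_onI)
    fix p q assume "p \<in> stat_pairs n" "q \<in> stat_pairs n" "?c p = ?c q"
    with r[of p] r[of q] show "p = q" by (simp add: cyc_class_eq_iff)
  qed
  have "{basis_vec cpk_cdes (cyc \<pi>) | \<pi>. is_perm \<pi> \<and> length \<pi> = n} =
      (\<lambda>A. Poly_Mapping.single A 1) ` ?c ` stat_pairs n" (is "?L = ?R")
  proof (intro equalityI subsetI)
    fix b assume "b \<in> ?L"
    then obtain \<pi> where \<pi>: "b = basis_vec cpk_cdes (cyc \<pi>)" "is_perm \<pi>" "length \<pi> = n" by blast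
    then have p: "(cpk \<pi>, cdes \<pi>) \<in> stat_pairs n"
      using stat_in_range[of \<pi>] range by (simp add: is_perm_def)
    have "?c (cpk \<pi>, cdes \<pi>) = cyc_class cpk_cdes (cyc \<pi>)"
      using r[OF p] \<pi> by (simp add: cyc_class_eq_iff)
    then have "b = Poly_Mapping.single (?c (cpk \<pi>, cdes \<pi>)) 1"
      by (simp add: \<pi>(1) basis_vec_def)
    with p show "b \<in> ?R" by blast
  next
    fix b assume "b \<in> ?R"
    then obtain p where "p \<in> stat_pairs n" "b = basis_vec cpk_cdes (cyc (r p))"
      by (auto simp: basis_vec_def)
    with r[of p] show "b \<in> ?L" by blast
  qed
  then have "cvec.dim (cyc_alg_comp cpk_cdes n) = card ((\<lambda>A. Poly_Mapping.single A (1::rat)) ` ?c ` stat_pairs n)"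
    unfolding cyc_alg_comp_def
    by (simp only: cvec.dim_span_eq_card_independent[OF independent_singles])
  also have "\<dots> = card (stat_pairs n)"
    using inj by (simp add: card_image inj_on_def single_1_inject)
  finally show ?thesis .
qed

lemma floor_quarter_square: "int ((n div 2) * (n - n div 2)) = \<lfloor>real n ^ 2 / 4\<rfloor>"
proof (cases "even n")
  case True
  then obtain h where h: "n = 2 * h" by blast
  then have "real n ^ 2 / 4 = of_int (int (h * h))"
    by (simp add: power2_eq_square)
  then have "\<lfloor>real n ^ 2 / 4\<rfloor> = int (h * h)"
    by (simp only: floor_of_int)
  then show ?thesis by (simp add: h)
next
  case False
  then obtain h where h: "n = 2 * h + 1" using oddE by blast
  then have "real n ^ 2 / 4 = real (h * (h + 1)) + 1 / 4"
    by (simp add: power2_eq_square field_simps)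
  then have "\<lfloor>real n ^ 2 / 4\<rfloor> = int (h * (h + 1))"
    by (simp add: floor_eq_iff)
  then show ?thesis by (simp add: h)
qed

theorem theorem4p8:
  shows
   "cyclic_shuffle_compatible cpk_cdes \<and>
    (\<forall>n j k. vseries n j k = monom
       ((of_int j * (yvar + tvar) * (1 + yvar * tvar) * (1 + yvar + tvar + yvar * tvar)
           + (of_int (k - j) * (1 + yvar * tvar) + of_int (int n - j - k) * (yvar + tvar))
              * tvar * (1 + yvar) ^ 2)
        * (tvar powi j * (yvar + tvar) powi (k - j - 1)
           * (1 + yvar * tvar) powi (int n - j - k - 1) * (1 + yvar) powi (2 * j - 1)
           / (1 - tvar) ^ (n + 1))) n) \<and>
    gens \<subseteq> range embed_lau \<and>
    is_subalgebra (target.span (as_target ` gens)) \<and>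
    (\<exists>\<phi>. is_cyc_alg_hom cpk_cdes \<phi> (target.span (as_target ` gens)) \<and>
       (\<forall>\<pi>. is_perm \<pi> \<longrightarrow> \<phi> (basis_vec cpk_cdes (cyc \<pi>)) =
          as_target (if length \<pi> \<ge> 1 then vseries (length \<pi>) (int (cpk \<pi>)) (int (cdes \<pi>))
                     else monom (1 / (1 - tvar)) 0))) \<and>
    (\<forall>n\<ge>2. int (cvec.dim (cyc_alg_comp cpk_cdes n)) = \<lfloor>real n ^ 2 / 4\<rfloor>)"
proof (intro conjI allI impI)
  show "\<exists>\<phi>. is_cyc_alg_hom cpk_cdes \<phi> target_span \<and>
       (\<forall>\<pi>. is_perm \<pi> \<longrightarrow> \<phi> (basis_vec cpk_cdes (cyc \<pi>)) =
          as_target (if length \<pi> \<ge> 1 then vseries (length \<pi>) (int (cpk \<pi>)) (int (cdes \<pi>))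
                     else monom (1 / (1 - tvar)) 0))"
    unfolding perm_series_def[symmetric]
    using is_cyc_alg_hom_hom_map hom_map_basis_vec as_target_perm_series
    by (intro exI[of _ hom_map]) (simp add: is_perm_def)
  show "int (cvec.dim (cyc_alg_comp cpk_cdes n)) = \<lfloor>real n ^ 2 / 4\<rfloor>" if "2 \<le> n" for n
    using that by (simp only: dim_cyc_alg_comp card_stat_pairs floor_quarter_square)
qed (rule cyclic_shuffle_compatible_cpk_cdes vseries_closed_form gens_subset_range
    is_subalgebra_target_span)+

end
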